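(* Let $G$ be a graph on $n$ vertices and let $\ell\ge\chi(G)+1$. If $G$ is $(P_3+P_1)$-free, then $\operatorname{diam}\mathcal{C}_\ell(G)\le\lfloor(4+1/2)n\rfloor$. If $G$ is $(2K_2,C_4)$-free, then $\operatorname{diam}\mathcal{C}_\ell(G)\le\lfloor 7n/2\rfloor$.
   Context: $\chi(G)$ is the chromatic number of $G$. $P_3+P_1$ is the disjoint union of a path on $3$ vertices and a single vertex; $2K_2$ is the disjoint union of two edges; $C_4$ is the cycle on $4$ vertices. A graph is $H$-free if it has no induced subgraph isomorphic to $H$, and $(H_1,H_2)$-free if it is both $H_1$-free and $H_2$-free. $\mathcal{C}_\ell(G)$ is the graph whose vertices are the proper vertex colourings of $G$ with colours from $\{1,\dots,\ell\}$, two being adjacent precisely when they differ in the colour of exactly one vertex; its diameter is the maximum distance between two of its vertices ($\infty$ if disconnected). *)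

theory Defs
  imports Complex_Main "HOL-Library.FuncSet" "HOL-Library.Extended_Nat"
begin

record 'a graph =
  verts :: "'a set"
  edges :: "'a set set"

definition simple_graph :: "'a graph \<Rightarrow> bool" where
  "simple_graph G \<longleftrightarrow> (\<forall>e\<in>edges G. e \<subseteq> verts G \<and> card e = 2)"

definition finite_simple_graph :: "'a graph \<Rightarrow> bool" where
  "finite_simple_graph G \<longleftrightarrow> simple_graph G \<and> finite (verts G)"

definition path_graph :: "nat \<Rightarrow> nat graph" where
  "path_graph n = \<lparr>verts = {..<n}, edges = {{i, Suc i} | i. Suc i < n}\<rparr>"

text \<open>For \<open>n \<ge> 3\<close> only; smaller values of \<open>n\<close> do not give a cycle.\<close>

definition cycle_graph :: "nat \<Rightarrow> nat graph" where
  "cycle_graph n = \<lparr>verts = {..<n}, edges = {{i, Suc i mod n} | i. i < n}\<rparr>"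

definition complete_graph :: "nat \<Rightarrow> nat graph" where
  "complete_graph n = \<lparr>verts = {..<n}, edges = {{i, j} | i j. i < n \<and> j < n \<and> i \<noteq> j}\<rparr>"

definition disjoint_union_graph :: "'a graph \<Rightarrow> 'b graph \<Rightarrow> ('a + 'b) graph" where
  "disjoint_union_graph G H =
     \<lparr>verts = verts G <+> verts H,
      edges = (image Inl ` edges G) \<union> (image Inr ` edges H)\<rparr>"

definition P3_plus_P1 :: "(nat + nat) graph" where
  "P3_plus_P1 = disjoint_union_graph (path_graph 3) (path_graph 1)"

definition two_K2 :: "(nat + nat) graph" where
  "two_K2 = disjoint_union_graph (complete_graph 2) (complete_graph 2)"

definition C4 :: "nat graph" where
  "C4 = cycle_graph 4"

definition induced_subgraph :: "'a graph \<Rightarrow> 'a set \<Rightarrow> 'a graph" where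
  "induced_subgraph G S = \<lparr>verts = S, edges = {e \<in> edges G. e \<subseteq> S}\<rparr>"

definition graph_isomorphic :: "'a graph \<Rightarrow> 'b graph \<Rightarrow> bool" where
  "graph_isomorphic G H \<longleftrightarrow>
     (\<exists>f. bij_betw f (verts G) (verts H) \<and> edges H = image f ` edges G)"

definition induced_free :: "'b graph \<Rightarrow> 'a graph \<Rightarrow> bool" where
  "induced_free H G \<longleftrightarrow>
     \<not> (\<exists>S\<subseteq>verts G. graph_isomorphic (induced_subgraph G S) H)"

text \<open>
  Colourings are extensional functions (equal to \<^const>\<open>undefined\<close> outside the vertex
  set), so that two of them are equal as soon as they agree on all vertices.
\<close>

definition proper_colourings :: "'a graph \<Rightarrow> nat \<Rightarrow> ('a \<Rightarrow> nat) set" where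
  "proper_colourings G l =
     {c \<in> verts G \<rightarrow>\<^sub>E {1..l}. \<forall>u v. {u, v} \<in> edges G \<longrightarrow> c u \<noteq> c v}"

definition chromatic_number :: "'a graph \<Rightarrow> nat" where
  "chromatic_number G = (LEAST k. proper_colourings G k \<noteq> {})"

definition colouring_graph :: "nat \<Rightarrow> 'a graph \<Rightarrow> ('a \<Rightarrow> nat) graph" where
  "colouring_graph l G =
     \<lparr>verts = proper_colourings G l,
      edges = {{c, d} | c d. c \<in> proper_colourings G l \<and> d \<in> proper_colourings G l \<and>
                             (\<exists>!v. v \<in> verts G \<and> c v \<noteq> d v)}\<rparr>"

definition adjacency :: "'a graph \<Rightarrow> 'a rel" where
  "adjacency G = {(u, v). {u, v} \<in> edges G}"

text \<open>
  The distance is the least length of a walk; the infimum of the empty set is \<open>\<infinity>\<close>,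
  so vertices in different components are at distance \<open>\<infinity>\<close>.
\<close>

definition graph_distance :: "'a graph \<Rightarrow> 'a \<Rightarrow> 'a \<Rightarrow> enat" where
  "graph_distance G u v = Inf {enat k | k. (u, v) \<in> adjacency G ^^ k}"

definition diameter :: "'a graph \<Rightarrow> enat" where
  "diameter G = Sup {graph_distance G u v | u v. u \<in> verts G \<and> v \<in> verts G}"


lemma simple_graph_P3_plus_P1: "finite_simple_graph P3_plus_P1"
  by (auto simp: finite_simple_graph_def simple_graph_def P3_plus_P1_def
      disjoint_union_graph_def path_graph_def card_insert_if)

lemma simple_graph_two_K2: "finite_simple_graph two_K2"
  by (auto simp: finite_simple_graph_def simple_graph_def two_K2_def
      disjoint_union_graph_def complete_graph_def card_insert_if)

lemma C4_edges: "edges C4 = {{0, 1}, {1, 2}, {2, 3}, {3, 0}}"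
proof -
  have less: "{i. i < 4} = {0, 1, 2, 3::nat}"
    by auto
  have "Suc 0 mod 4 = 1" "Suc 1 mod 4 = 2" "Suc 2 mod 4 = 3" "Suc 3 mod 4 = 0"
    by simp_all
  then show ?thesis
    unfolding C4_def cycle_graph_def graph.simps setcompr_eq_image less
    by (simp only: image_insert image_empty)
qed

lemma simple_graph_C4: "finite_simple_graph C4"
  unfolding finite_simple_graph_def simple_graph_def C4_edges
  by (auto simp: C4_def cycle_graph_def)

lemma simple_graph_colouring_graph: "simple_graph (colouring_graph l G)"
  by (auto simp: simple_graph_def colouring_graph_def card_insert_if)

lemma proper_colourings_mono:
  assumes "k \<le> l"
  shows "proper_colourings G k \<subseteq> proper_colourings G l"
  using assms by (fastforce simp: proper_colourings_def PiE_iff)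

lemma proper_colourings_chromatic_number:
  assumes "finite_simple_graph G"
  shows "proper_colourings G (chromatic_number G) \<noteq> {}"
proof -
  from assms have fin: "finite (verts G)"
    and e: "\<And>u v. {u, v} \<in> edges G \<Longrightarrow> u \<in> verts G \<and> v \<in> verts G \<and> u \<noteq> v"
    by (force simp: finite_simple_graph_def simple_graph_def)+
  obtain f where f: "bij_betw f (verts G) {1..card (verts G)}"
    using fin finite_same_card_bij[of "verts G" "{1..card (verts G)}"] by auto
  have "restrict f (verts G) \<in> proper_colourings G (card (verts G))"
    using f e by (auto simp: proper_colourings_def bij_betw_def inj_on_def)
  then have "proper_colourings G (card (verts G)) \<noteq> {}"
    by blast
  then show ?thesis
    unfolding chromatic_number_def by (rule LeastI)
qed

end

theory Submission
  imports Defs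
begin

text \<open>
  Both colourings are led to one canonical partition into \<open>\<chi>(G)\<close> classes, and then the colours of
  its classes are permuted, at a cost of at most \<open>3n/2\<close>, which a cycle of two classes of equal
  size needs. Reaching the partition costs at most \<open>3n/2\<close> if \<open>G\<close> is \<open>(P\<^sub>3 + P\<^sub>1)\<close>-free and at most
  \<open>n\<close> if \<open>G\<close> is \<open>(2K\<^sub>2, C\<^sub>4)\<close>-free.

  A \<open>(P\<^sub>3 + P\<^sub>1)\<close>-free graph is a join of graphs without three independent vertices and of disjoint
  unions of cliques. In a join, either some colour is unused or some part uses more colours than
  it needs, so there is always a part that can be recoloured on its own with a colour to spare.

  A \<open>(2K\<^sub>2, C\<^sub>4)\<close>-free graph is a split graph, or a \<open>C\<^sub>5\<close> complete to a clique and anticomplete to an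
  independent set. The clique is never recoloured, and each vertex of the independent set moves
  once, to the colour of a non-neighbour.
\<close>

section \<open>Recolouring one vertex at a time\<close>

text \<open>The obstacle is to keep a colour to spare inside a part. The colours available there are
  those that the rest of the graph does not block, and they change while the rest is recoloured.
  This is why the palette is an arbitrary finite set of colours, and why the canonical partition
  must use as few classes as possible: in a join the minimum numbers of colours add up, so a part
  that has reached its minimum leaves enough to the others. The partition also has to be chosen
  before the palette and the starting colouring are known, because the two given colourings are to
  meet there; hence it is fixed only up to the names of its colours, and the names are repaired at
  the end. In the first case the factor 3/2 for reaching the partition comes from disjoint unions of
  cliques, where a clique has to permute its colours to line up with the others; parts without three
  independent vertices cost one step per vertex. Only the adjacency relation is kept of the graph,
  so that parts are plain vertex sets under one and the same relation.\<close>

locale adjacency_relation =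
  fixes E :: "'a \<Rightarrow> 'a \<Rightarrow> bool"
  assumes sym: "E u v \<Longrightarrow> E v u"
    and irrefl: "\<not> E u u"
begin

definition proper_on :: "'a set \<Rightarrow> ('a \<Rightarrow> nat) \<Rightarrow> bool" where
  "proper_on U c \<longleftrightarrow> (\<forall>u\<in>U. \<forall>v\<in>U. E u v \<longrightarrow> c u \<noteq> c v)"

text \<open>A partition is represented by any colouring that has it as its set of colour classes.
  Targets are stated up to this equivalence, since their actual colours depend on the palette and on
  the start.\<close>

definition same_kernel :: "'a set \<Rightarrow> ('a \<Rightarrow> nat) \<Rightarrow> ('a \<Rightarrow> nat) \<Rightarrow> bool" where
  "same_kernel U c d \<longleftrightarrow> (\<forall>u\<in>U. \<forall>v\<in>U. c u = c v \<longleftrightarrow> d u = d v)"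

text \<open>The index is an upper bound on the number of steps, and a step may leave the colour unchanged.\<close>

inductive recolours :: "'a set \<Rightarrow> nat set \<Rightarrow> nat \<Rightarrow> ('a \<Rightarrow> nat) \<Rightarrow> ('a \<Rightarrow> nat) \<Rightarrow> bool"
  for U :: "'a set" and L :: "nat set" where
  refl: "recolours U L k c c"
| step: "recolours U L k c d \<Longrightarrow> v \<in> U \<Longrightarrow> x \<in> L \<Longrightarrow> (\<And>u. u \<in> U \<Longrightarrow> E u v \<Longrightarrow> d u \<noteq> x) \<Longrightarrow>
    recolours U L (Suc k) c (d(v := x))"

lemma proper_onD: "proper_on U c \<Longrightarrow> u \<in> U \<Longrightarrow> v \<in> U \<Longrightarrow> E u v \<Longrightarrow> c u \<noteq> c v"
  by (auto simp: proper_on_def)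

lemma proper_on_subset: "proper_on U c \<Longrightarrow> W \<subseteq> U \<Longrightarrow> proper_on W c"
  by (auto simp: proper_on_def)

lemma proper_on_cong_kernel: "same_kernel U c d \<Longrightarrow> proper_on U c \<longleftrightarrow> proper_on U d"
  unfolding proper_on_def same_kernel_def by blast

lemma same_kernel_card:
  assumes "same_kernel U c d"
  shows "card (c ` U) = card (d ` U)"
proof -
  define h where "h x = d (SOME u. u \<in> U \<and> c u = x)" for x
  have h: "h (c u) = d u" if "u \<in> U" for u
  proof -
    have "(SOME w. w \<in> U \<and> c w = c u) \<in> U \<and> c (SOME w. w \<in> U \<and> c w = c u) = c u"
      using that by (intro someI[of "\<lambda>w. w \<in> U \<and> c w = c u" u]) auto
    with assms that show ?thesis by (auto simp: h_def same_kernel_def)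
  qed
  have "bij_betw h (c ` U) (d ` U)"
    unfolding bij_betw_def inj_on_def
    using h assms by (auto simp: same_kernel_def image_image)
  then show ?thesis by (rule bij_betw_same_card)
qed

lemma proper_on_inj_clique:
  assumes "proper_on U c" "K \<subseteq> U" "\<And>u v. u \<in> K \<Longrightarrow> v \<in> K \<Longrightarrow> u \<noteq> v \<Longrightarrow> E u v"
  shows "inj_on c K"
  using assms unfolding proper_on_def inj_on_def by blast

lemma recolours_mono: "recolours U L k c d \<Longrightarrow> k \<le> k' \<Longrightarrow> recolours U L k' c d"
proof (induction arbitrary: k' rule: recolours.induct)
  case (step k c d v x)
  then obtain j where j: "k' = Suc j" "k \<le> j" by (cases k') auto
  show ?case unfolding j(1) using step j(2) by (intro recolours.step) auto
qed (rule recolours.refl)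

text \<open>The later stretch is the first premise because the induction runs over its steps, the
  last one being peeled off.\<close>

lemma recolours_trans:
  assumes "recolours U L j d e" "recolours U L k c d"
  shows "recolours U L (k + j) c e"
  using assms
proof (induction rule: recolours.induct)
  case (refl j d)
  then show ?case by (rule recolours_mono) simp
next
  case (step j d e v x)
  then show ?case unfolding add_Suc_right by (intro recolours.step) auto
qed

lemma recolours_proper: "recolours U L k c d \<Longrightarrow> proper_on U c \<Longrightarrow> proper_on U d"
proof (induction rule: recolours.induct)
  case (step k c d v x)
  then have d: "proper_on U d" by blast
  show ?case unfolding proper_on_def
  proof (intro ballI impI)
    fix u w assume "u \<in> U" "w \<in> U" "E u w"
    then show "(d(v := x)) u \<noteq> (d(v := x)) w"
      using step(4)[of u] step(4)[of w] sym[of u w] irrefl[of u] proper_onD[OF d, of u w]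
      by auto
  qed
qed

lemma recolours_image: "recolours U L k c d \<Longrightarrow> c ` U \<subseteq> L \<Longrightarrow> d ` U \<subseteq> L"
  by (induction rule: recolours.induct) auto

lemma recolours_outside: "recolours U L k c d \<Longrightarrow> u \<notin> U \<Longrightarrow> d u = c u"
  by (induction rule: recolours.induct) auto

text \<open>Undoing a step restores the old colour of a vertex. It is allowed because the earlier
  colouring was proper and within the palette, which the two hypotheses on \<open>c\<close>
  guarantee all along.\<close>

lemma recolours_sym:
  "recolours U L k c d \<Longrightarrow> proper_on U c \<Longrightarrow> c ` U \<subseteq> L \<Longrightarrow> recolours U L k d c"
proof (induction rule: recolours.induct)
  case (step k c d v x)
  have d: "proper_on U d" "d ` U \<subseteq> L"
    using recolours_proper[OF step(1)] recolours_image[OF step(1)] step(6,7) by simp_all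
  have "recolours U L (Suc 0) (d(v := x)) ((d(v := x))(v := d v))"
  proof (rule recolours.step[OF recolours.refl])
    show "v \<in> U" "d v \<in> L" using step d by auto
    show "(d(v := x)) u \<noteq> d v" if "u \<in> U" "E u v" for u
      using that d(1) step(2) irrefl by (auto simp: proper_on_def)
  qed
  then have "recolours U L (Suc 0) (d(v := x)) d" by simp
  from recolours_trans[OF step(5)[OF step(6,7)] this] show ?case by (simp only: add_Suc add_0)
qed (rule recolours.refl)

text \<open>Vertices outside \<open>U\<close> keep their colours under \<open>c\<close>, so one
  condition at the start excludes clashes throughout. It is met in a join by a palette that avoids
  the colours of the other part, and in a disjoint union by the absence of edges.\<close>

lemma recolours_lift:
  assumes "recolours U L k c d" "U \<subseteq> V" "L \<subseteq> L'"
    and "\<And>u w. u \<in> U \<Longrightarrow> w \<in> V - U \<Longrightarrow> E u w \<Longrightarrow> c w \<notin> L"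
  shows "recolours V L' k c d"
  using assms
proof (induction rule: recolours.induct)
  case (step k c d v x)
  show ?case
  proof (rule recolours.step)
    show "recolours V L' k c d" using step by blast
    show "v \<in> V" "x \<in> L'" using step by auto
    show "d u \<noteq> x" if "u \<in> V" "E u v" for u
    proof (cases "u \<in> U")
      case False
      then have "d u = c u" using recolours_outside step(1) by blast
      moreover have "c u \<notin> L" using step that False sym by blast
      ultimately show ?thesis using step by auto
    qed (use step that in blast)
  qed
qed (rule recolours.refl)

text \<open>Any order works: members of \<open>S\<close> never block each other, and the other
  vertices still have their colours under \<open>c\<close> when a member of \<open>S\<close> is
  moved.\<close>

lemma recolours_independent:
  assumes "finite S" "S \<subseteq> U" "t ` S \<subseteq> L"
    and "\<And>u v. u \<in> S \<Longrightarrow> v \<in> S \<Longrightarrow> \<not> E u v"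
    and "\<And>s w. s \<in> S \<Longrightarrow> w \<in> U - S \<Longrightarrow> E s w \<Longrightarrow> c w \<noteq> t s"
  shows "recolours U L (card S) c (\<lambda>v. if v \<in> S then t v else c v)"
proof -
  have "T \<subseteq> S \<Longrightarrow> recolours U L (card T) c (\<lambda>v. if v \<in> T then t v else c v)" if "finite T" for T
    using that
  proof (induction T)
    case empty
    then show ?case by (simp add: recolours.refl)
  next
    case (insert s T)
    have "(\<lambda>v. if v \<in> insert s T then t v else c v) =
      (\<lambda>v. if v \<in> T then t v else c v)(s := t s)" by auto
    moreover have "recolours U L (Suc (card T)) c ((\<lambda>v. if v \<in> T then t v else c v)(s := t s))"
    proof (rule recolours.step)
      show "recolours U L (card T) c (\<lambda>v. if v \<in> T then t v else c v)" using insert by blast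
      show "s \<in> U" "t s \<in> L" using insert assms by auto
      show "(if u \<in> T then t u else c u) \<noteq> t s" if "u \<in> U" "E u s" for u
      proof -
        have "s \<in> S" using insert by auto
        moreover have "u \<notin> S" using that assms(4) \<open>s \<in> S\<close> by blast
        ultimately show ?thesis using assms(5)[of s u] that sym insert by auto
      qed
    qed
    ultimately show ?case using insert by simp
  qed
  then show ?thesis using assms(1) by blast
qed

lemma recolours_gather:
  assumes "finite S" "S \<subseteq> U" "f \<in> L" "\<And>u v. u \<in> S \<Longrightarrow> v \<in> S \<Longrightarrow> \<not> E u v" "f \<notin> c ` (U - S)"
  shows "recolours U L (card S) c (\<lambda>v. if v \<in> S then f else c v)"
  using assms by (intro recolours_independent[where t = "\<lambda>_. f"]) auto

section \<open>Renaming the colours of a fixed partition\<close>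

lemma recolours_class:
  assumes "finite U" "proper_on U c" "same_kernel U c b" "s \<in> U" "f \<in> L" "f \<notin> c ` U"
    and S: "S = {v \<in> U. b v = b s}"
  defines "c' \<equiv> \<lambda>v. if v \<in> S then f else c v"
  shows "recolours U L (card S) c c'" "proper_on U c'" "same_kernel U c' b"
proof -
  have ind: "\<not> E u v" if "u \<in> S" "v \<in> S" for u v
    using that assms(2,3) unfolding S proper_on_def same_kernel_def by (metis (mono_tags, lifting) mem_Collect_eq)
  show r: "recolours U L (card S) c c'"
    unfolding c'_def using assms ind by (intro recolours_gather) auto
  show "proper_on U c'" using recolours_proper[OF r] assms(2) .
  show "same_kernel U c' b"
    using assms(3,4,6) unfolding same_kernel_def c'_def S by auto
qed

text \<open>If \<open>b\<close> and \<open>c\<close> have the same kernel, this is a union of whole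
  classes. Its size is the potential that pays for the renaming.\<close>

definition miscoloured :: "'a set \<Rightarrow> ('a \<Rightarrow> nat) \<Rightarrow> ('a \<Rightarrow> nat) \<Rightarrow> 'a set" where
  "miscoloured U b c = {v \<in> U. c v \<noteq> b v}"

lemma miscoloured_class:
  assumes "same_kernel U c b" "s \<in> miscoloured U b c"
  shows "{v \<in> U. b v = b s} \<subseteq> miscoloured U b c"
proof
  fix v assume v: "v \<in> {v \<in> U. b v = b s}"
  with assms have "c v = c s" unfolding same_kernel_def miscoloured_def by blast
  with v assms(2) show "v \<in> miscoloured U b c" by (simp add: miscoloured_def)
qed

text \<open>
  A cycle of \<open>m\<close> classes that have to exchange their colours is resolved by parking its smallest
  class on a spare colour. The second claim is about such a parked class \<open>s\<close>: its current
  colour is nobody's target, so some target colour is unused, and the class waiting for that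
  colour can be moved.
\<close>

lemma rename_aux:
  assumes "finite U" "finite L" "b ` U \<subseteq> L" "card (b ` U) < card L"
    and "proper_on U c" "same_kernel U c b" "c ` U \<subseteq> L"
  shows "(\<exists>r. 2 * r \<le> 3 * card (miscoloured U b c) \<and>
            recolours U L r c (\<lambda>v. if v \<in> U then b v else c v)) \<and>
         (\<forall>s \<in> miscoloured U b c. c s \<notin> b ` U \<longrightarrow>
            (\<exists>r. 2 * r + card {v \<in> U. b v = b s} \<le> 3 * card (miscoloured U b c) \<and>
               recolours U L r c (\<lambda>v. if v \<in> U then b v else c v)))"
  using assms(5-7)
proof (induction "card (miscoloured U b c)" arbitrary: c rule: less_induct)
  case less
  define M where "M = miscoloured U b"
  define cl where "cl s = {v \<in> U. b v = b s}" for s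
  define goal where "goal c = (\<lambda>v. if v \<in> U then b v else c v)" for c :: "'a \<Rightarrow> nat"
  have finM: "finite (M d)" for d using assms(1) by (simp add: M_def miscoloured_def)
  \<comment> \<open>A class whose target colour is free goes straight home. This takes one step per
    vertex, while the potential releases 3/2 per vertex: half a step per vertex is saved.\<close>
  have move: "\<exists>e. recolours U L (card (cl t)) d e \<and> proper_on U e \<and> same_kernel U e b \<and> e ` U \<subseteq> L \<and>
      M e = M d - cl t \<and> card (M e) + card (cl t) = card (M d) \<and> card (cl t) > 0 \<and>
      (\<forall>v. v \<notin> cl t \<longrightarrow> e v = d v) \<and> goal e = goal d"
    if "t \<in> M d" "b t \<notin> d ` U" "proper_on U d" "same_kernel U d b" "d ` U \<subseteq> L" for t d
  proof -
    define e where "e = (\<lambda>v. if v \<in> cl t then b t else d v)"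
    have tU: "t \<in> U" using that by (auto simp: M_def miscoloured_def)
    have e: "recolours U L (card (cl t)) d e" "proper_on U e" "same_kernel U e b"
      using recolours_class[of U d b t "b t" L "cl t"] that assms tU by (auto simp: e_def cl_def)
    have "e ` U \<subseteq> L" using recolours_image[OF e(1) that(5)] .
    moreover have Me: "M e = M d - cl t" by (auto simp: M_def miscoloured_def e_def cl_def)
    moreover have sub: "cl t \<subseteq> M d"
      unfolding cl_def M_def using that(1,4) by (intro miscoloured_class) (simp_all add: M_def)
    moreover have "card (M e) + card (cl t) = card (M d)"
      unfolding Me using card_Diff_subset[OF finite_subset[OF sub finM] sub] card_mono[OF finM sub] by simp
    moreover have "card (cl t) > 0"
      using tU assms(1) by (auto simp: card_gt_0_iff cl_def)
    moreover have "goal e = goal d" by (auto simp: goal_def e_def cl_def)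
    moreover have "\<forall>v. v \<notin> cl t \<longrightarrow> e v = d v" by (simp add: e_def)
    ultimately show ?thesis using e by (intro exI[of _ e] conjI)
  qed
  have cardeq: "card (d ` U) = card (b ` U)" if "same_kernel U d b" for d
    using that same_kernel_card by blast
  have IHA: "\<exists>r. 2 * r \<le> 3 * card (M e) \<and> recolours U L r e (goal e)"
    if "card (M e) < card (M c)" "proper_on U e" "same_kernel U e b" "e ` U \<subseteq> L" for e
    using less.hyps[of e] that unfolding M_def goal_def by blast
  have IHE: "\<exists>r. 2 * r + card (cl s) \<le> 3 * card (M e) \<and> recolours U L r e (goal e)"
    if "card (M e) < card (M c)" "proper_on U e" "same_kernel U e b" "e ` U \<subseteq> L"
      "s \<in> M e" "e s \<notin> b ` U" for e s
    using less.hyps[of e] that unfolding M_def goal_def cl_def by blast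
  \<comment> \<open>The term \<open>card (cl s)\<close> records the half step per vertex that the
    final move of the class of \<open>s\<close> will save.\<close>
  have E: "\<exists>r. 2 * r + card (cl s) \<le> 3 * card (M c) \<and> recolours U L r c (goal c)"
    if s: "s \<in> M c" "c s \<notin> b ` U" for s
  proof -
    have sU: "s \<in> U" using s by (auto simp: M_def miscoloured_def)
    have "\<not> b ` U \<subseteq> c ` U"
    proof
      assume "b ` U \<subseteq> c ` U"
      then have "b ` U = c ` U"
        using cardeq[OF less.prems(2)] assms(1) by (simp add: card_subset_eq)
      then show False using s sU by auto
    qed
    then obtain t where t: "t \<in> U" "b t \<notin> c ` U" by auto
    then have "c t \<noteq> b t" by (metis imageI)
    with t have tM: "t \<in> M c" by (simp add: M_def miscoloured_def)
    from move[OF tM t(2) less.prems] obtain e where e: "recolours U L (card (cl t)) c e"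
      "proper_on U e" "same_kernel U e b" "e ` U \<subseteq> L" "M e = M c - cl t"
      "card (M e) + card (cl t) = card (M c)" "card (cl t) > 0"
      "\<forall>v. v \<notin> cl t \<longrightarrow> e v = c v" "goal e = goal c" by blast
    show ?thesis
    proof (cases "b t = b s")
      case True
      then have "cl t = cl s" by (auto simp: cl_def)
      moreover obtain r where "2 * r \<le> 3 * card (M e)" "recolours U L r e (goal e)"
        using IHA[of e] e by auto
      ultimately show ?thesis
        using recolours_trans[OF _ e(1)] e(6,9) by (intro exI[of _ "card (cl t) + r"]) auto
    next
      case False
      then have ns: "s \<notin> cl t" by (auto simp: cl_def)
      then obtain r where "2 * r + card (cl s) \<le> 3 * card (M e)" "recolours U L r e (goal e)"
        using IHE[of e s] e s by auto
      then show ?thesis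
        using recolours_trans[OF _ e(1)] e(6,9) by (intro exI[of _ "card (cl t) + r"]) auto
    qed
  qed
  have A: "\<exists>r. 2 * r \<le> 3 * card (M c) \<and> recolours U L r c (goal c)"
  proof (cases "M c = {}")
    case True
    then have "goal c = c" by (auto simp: goal_def M_def miscoloured_def)
    then show ?thesis by (metis recolours.refl mult_0_right zero_le)
  next
    case ne: False
    show ?thesis
    proof (cases "\<exists>t \<in> M c. b t \<notin> c ` U")
      case True
      then obtain t where t: "t \<in> M c" "b t \<notin> c ` U" by blast
      from move[OF t less.prems] obtain e where e: "recolours U L (card (cl t)) c e"
        "proper_on U e" "same_kernel U e b" "e ` U \<subseteq> L"
        "card (M e) + card (cl t) = card (M c)" "card (cl t) > 0" "goal e = goal c" by blast
      then obtain r where "2 * r \<le> 3 * card (M e)" "recolours U L r e (goal e)"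
        using IHA[of e] by auto
      then show ?thesis
        using recolours_trans[OF _ e(1)] e(5,7) by (intro exI[of _ "card (cl t) + r"]) auto
    next
      case False
      have "b ` U \<subseteq> c ` U"
      proof
        fix x assume "x \<in> b ` U"
        then obtain u where "u \<in> U" "x = b u" by blast
        with False imageI[of u U c] show "x \<in> c ` U"
          by (cases "c u = b u") (auto simp: M_def miscoloured_def)
      qed
      then have bc: "b ` U = c ` U"
        using cardeq[OF less.prems(2)] assms(1) by (simp add: card_subset_eq)
      \<comment> \<open>Parking \<open>s\<close> costs \<open>card (cl s)\<close> extra. Half of it
        is repaid by the saving on the final move of \<open>s\<close>, the other half by the saving
        on the move of \<open>t\<close>, the class that waits for the colour of \<open>s\<close>;
        this needs \<open>card (cl s) \<le> card (cl t)\<close>, hence the minimum.\<close>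
      obtain s where s: "s \<in> M c" "\<forall>u \<in> M c. card (cl s) \<le> card (cl u)"
        using ne ex_min_if_finite[of "(\<lambda>u. card (cl u)) ` M c"] finM
        by (metis (no_types, lifting) arg_min_if_finite(1) arg_min_least)
      have sU: "s \<in> U" "c s \<noteq> b s" using s by (auto simp: M_def miscoloured_def)
      then have "c s \<in> b ` U" using bc by blast
      then obtain t where t: "t \<in> U" "b t = c s" by auto
      have tM: "t \<in> M c"
        using t sU less.prems(2) by (auto simp: M_def miscoloured_def same_kernel_def)
      obtain f where f: "f \<in> L" "f \<notin> c ` U"
        using assms(2,4) bc by (metis card_mono leD subsetI finite_imageI assms(1))
      define c1 where "c1 = (\<lambda>v. if v \<in> cl s then f else c v)"
      have c1: "recolours U L (card (cl s)) c c1" "proper_on U c1" "same_kernel U c1 b"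
        using recolours_class[of U c b s f L "cl s"] assms less.prems sU f
        by (auto simp: c1_def cl_def)
      have L1: "c1 ` U \<subseteq> L" using recolours_image[OF c1(1) less.prems(3)] .
      \<comment> \<open>Parking does not change the potential: \<open>s\<close> was miscoloured
        before, and \<open>f\<close> is nobody's target.\<close>
      have M1: "M c1 = M c"
        using f bc miscoloured_class[OF less.prems(2), of s] s
        by (auto simp: M_def miscoloured_def c1_def cl_def)
      have "b t \<notin> c1 ` U"
        using f t less.prems(2) sU bc by (auto simp: c1_def cl_def same_kernel_def)
      from move[OF _ this c1(2,3) L1] tM M1
      obtain e where e: "recolours U L (card (cl t)) c1 e"
        "proper_on U e" "same_kernel U e b" "e ` U \<subseteq> L" "M e = M c - cl t"
        "card (M e) + card (cl t) = card (M c)" "card (cl t) > 0"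
        "\<forall>v. v \<notin> cl t \<longrightarrow> e v = c1 v" "goal e = goal c1" by auto
      have st: "s \<notin> cl t" using sU t by (auto simp: cl_def)
      have "e s = f" using e(8) st sU by (auto simp: c1_def cl_def)
      then obtain r where r: "2 * r + card (cl s) \<le> 3 * card (M e)" "recolours U L r e (goal e)"
        using IHE[of e s] e s st f bc by auto
      have "goal c1 = goal c" by (auto simp: goal_def c1_def cl_def)
      then have "recolours U L (card (cl s) + (card (cl t) + r)) c (goal c)"
        using recolours_trans[OF recolours_trans[OF r(2) e(1)] c1(1)] e(9) by simp
      moreover have "card (cl s) \<le> card (cl t)" using s tM by blast
      ultimately show ?thesis using r(1) e(6)
        by (intro exI[of _ "card (cl s) + (card (cl t) + r)"]) auto
    qed
  qed
  show ?case using A E unfolding M_def goal_def cl_def by blast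
qed

lemma rename:
  assumes "finite U" "finite L" "b ` U \<subseteq> L" "card (b ` U) < card L"
    and "proper_on U c" "same_kernel U c b" "c ` U \<subseteq> L"
  shows "recolours U L (3 * card U div 2) c (\<lambda>v. if v \<in> U then b v else c v)"
proof -
  obtain r where r: "2 * r \<le> 3 * card (miscoloured U b c)"
    "recolours U L r c (\<lambda>v. if v \<in> U then b v else c v)"
    using rename_aux[OF assms] by blast
  have "card (miscoloured U b c) \<le> card U"
    using assms(1) by (auto simp: miscoloured_def intro: card_mono)
  with r(1) have "r \<le> 3 * card U div 2" by linarith
  with r(2) show ?thesis by (rule recolours_mono)
qed

section \<open>Canonical partitions\<close>

text \<open>The colouring \<open>p\<close> stands for its partition, which has the least possible
  number of classes. One \<open>p\<close> and one bound \<open>m\<close> serve all palettes with at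
  least one colour more than that number, and all starting colourings.\<close>

definition canonical :: "'a set \<Rightarrow> nat \<Rightarrow> ('a \<Rightarrow> nat) \<Rightarrow> bool" where
  "canonical U m p \<longleftrightarrow> proper_on U p \<and> (\<forall>q. proper_on U q \<longrightarrow> card (p ` U) \<le> card (q ` U)) \<and>
     (\<forall>L c. finite L \<longrightarrow> proper_on U c \<longrightarrow> c ` U \<subseteq> L \<longrightarrow> card (p ` U) < card L \<longrightarrow>
        (\<exists>d. recolours U L m c d \<and> same_kernel U d p))"

lemma canonicalI:
  assumes "proper_on U p" "\<And>q. proper_on U q \<Longrightarrow> card (p ` U) \<le> card (q ` U)"
    and "\<And>L c. finite L \<Longrightarrow> proper_on U c \<Longrightarrow> c ` U \<subseteq> L \<Longrightarrow> card (p ` U) < card L \<Longrightarrow>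
      \<exists>d. recolours U L m c d \<and> same_kernel U d p"
  shows "canonical U m p"
  using assms by (simp add: canonical_def)

lemma canonical_proper: "canonical U m p \<Longrightarrow> proper_on U p"
  by (simp add: canonical_def)

lemma canonical_le: "canonical U m p \<Longrightarrow> proper_on U q \<Longrightarrow> card (p ` U) \<le> card (q ` U)"
  by (simp add: canonical_def)

lemma canonical_recolours:
  assumes "canonical U m p" "finite L" "proper_on U c" "c ` U \<subseteq> L" "card (p ` U) < card L"
  obtains d where "recolours U L m c d" "same_kernel U d p"
  using assms unfolding canonical_def by blast

lemma canonical_mono: "canonical U m p \<Longrightarrow> m \<le> m' \<Longrightarrow> canonical U m' p"
  unfolding canonical_def by (meson recolours_mono)

lemma same_kernel_Un:
  assumes "same_kernel A c d" "same_kernel B c d"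
    and "\<And>a b. a \<in> A \<Longrightarrow> b \<in> B \<Longrightarrow> c a = c b \<longleftrightarrow> d a = d b"
  shows "same_kernel (A \<union> B) c d"
  unfolding same_kernel_def
proof (intro ballI)
  fix u v assume "u \<in> A \<union> B" "v \<in> A \<union> B"
  then show "c u = c v \<longleftrightarrow> d u = d v"
    using assms(1,2) assms(3)[of u v] assms(3)[of v u] unfolding same_kernel_def
    by (metis UnE)
qed

lemma same_kernel_inj: "inj_on c U \<Longrightarrow> inj_on d U \<Longrightarrow> same_kernel U c d"
  unfolding same_kernel_def inj_on_def by blast

lemma same_kernel_cong:
  assumes "same_kernel U c d" "\<And>u. u \<in> U \<Longrightarrow> c' u = c u" "\<And>u. u \<in> U \<Longrightarrow> d' u = d u"
  shows "same_kernel U c' d'"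
  using assms by (simp add: same_kernel_def)

lemma card_image_join:
  assumes "finite A" "finite B" "\<And>a b. a \<in> A \<Longrightarrow> b \<in> B \<Longrightarrow> c a \<noteq> c b"
  shows "card (c ` (A \<union> B)) = card (c ` A) + card (c ` B)"
  unfolding image_Un using assms by (intro card_Un_disjoint) auto

text \<open>Every proper colouring of a clique is injective, so all of them have the same kernel and
  nothing has to move.\<close>

lemma canonical_clique:
  assumes "finite K" "\<And>u v. u \<in> K \<Longrightarrow> v \<in> K \<Longrightarrow> u \<noteq> v \<Longrightarrow> E u v"
  obtains p where "canonical K 0 p"
proof -
  obtain p :: "'a \<Rightarrow> nat" where p: "inj_on p K"
    using assms(1) finite_imp_inj_to_nat_seg by metis
  have inj: "inj_on q K" if "proper_on K q" for q
    using proper_on_inj_clique[OF that order_refl assms(2)] by blast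
  have "canonical K 0 p"
  proof (rule canonicalI)
    show "proper_on K p" using p irrefl by (auto simp: proper_on_def inj_on_def)
    show "card (p ` K) \<le> card (q ` K)" if "proper_on K q" for q
      using p inj[OF that] by (simp add: card_image)
    show "\<exists>d. recolours K L 0 c d \<and> same_kernel K d p" if "proper_on K c" for L c
      using recolours.refl same_kernel_inj[OF inj[OF that] p] by blast
  qed
  then show thesis by (rule that)
qed

lemma minimal_proper:
  assumes "finite U"
  obtains p where "proper_on U p" "\<And>q. proper_on U q \<Longrightarrow> card (p ` U) \<le> card (q ` U)"
proof -
  obtain g :: "'a \<Rightarrow> nat" where "inj_on g U"
    using assms finite_imp_inj_to_nat_seg by metis
  then have "proper_on U g" using irrefl by (auto simp: proper_on_def inj_on_def)
  then show thesis
    using ex_has_least_nat[of "proper_on U" g "\<lambda>q. card (q ` U)"] that by blast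
qed

text \<open>Both colourings go to the partition of \<open>p\<close>, the way from \<open>d\<close>
  being run backwards; in between only the names of the classes change. The condition outside
  \<open>V\<close> is there because colourings are total functions and are compared as such.\<close>

lemma canonical_connects:
  assumes "finite V" "canonical V m p" "finite L" "card (p ` V) < card L"
    and c: "proper_on V c" "c ` V \<subseteq> L" and d: "proper_on V d" "d ` V \<subseteq> L"
    and out: "\<And>v. v \<notin> V \<Longrightarrow> c v = d v"
  shows "recolours V L (2 * m + 3 * card V div 2) c d"
proof -
  obtain c' where c': "recolours V L m c c'" "same_kernel V c' p"
    using canonical_recolours[OF assms(2,3) c assms(4)] .
  obtain d' where d': "recolours V L m d d'" "same_kernel V d' p"
    using canonical_recolours[OF assms(2,3) d assms(4)] .
  have ker: "same_kernel V c' d'" using c'(2) d'(2) by (simp add: same_kernel_def)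
  have "card (d' ` V) < card L" using same_kernel_card[OF d'(2)] assms(4) by simp
  then have "recolours V L (3 * card V div 2) c' (\<lambda>v. if v \<in> V then d' v else c' v)"
    using rename[OF assms(1,3) recolours_image[OF d'(1) d(2)] _ recolours_proper[OF c'(1) c(1)] ker
        recolours_image[OF c'(1) c(2)]] by blast
  moreover have "(\<lambda>v. if v \<in> V then d' v else c' v) = d'"
    using recolours_outside[OF c'(1)] recolours_outside[OF d'(1)] out by auto
  ultimately have "recolours V L (3 * card V div 2) c' d'" by simp
  from recolours_trans[OF recolours_sym[OF d'(1) d] recolours_trans[OF this c'(1)]]
  have "recolours V L (m + 3 * card V div 2 + m) c d" .
  moreover have "m + 3 * card V div 2 + m = 2 * m + 3 * card V div 2" by simp
  ultimately show ?thesis by simp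
qed

section \<open>Joins\<close>

text \<open>The part with a colour to spare goes first; it releases whatever the other part then needs.\<close>

lemma join_recolours:
  assumes "finite A" "finite B" "A \<inter> B = {}" "\<And>a b. a \<in> A \<Longrightarrow> b \<in> B \<Longrightarrow> E a b"
    and A: "canonical A m p" and B: "canonical B m' p'"
    and c: "finite L" "proper_on (A \<union> B) c" "c ` (A \<union> B) \<subseteq> L"
    and L: "card (p ` A) + card (p' ` B) < card L" "card (p ` A) < card (L - c ` B)"
  obtains e where "recolours (A \<union> B) L (m + m') c e" "same_kernel A e p" "same_kernel B e p'"
proof -
  have sep: "d ` A \<inter> d ` B = {}" if "proper_on (A \<union> B) d" for d
    using that assms(4) unfolding proper_on_def by blast
  have "c ` A \<subseteq> L - c ` B" using c(3) sep[OF c(2)] by blast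
  then obtain d where d: "recolours A (L - c ` B) m c d" "same_kernel A d p"
    using canonical_recolours[OF A, of "L - c ` B" c] c L(2) proper_on_subset[OF c(2), of A] by auto
  have d': "recolours (A \<union> B) L m c d" by (rule recolours_lift[OF d(1)]) auto
  have pd: "proper_on (A \<union> B) d" "d ` (A \<union> B) \<subseteq> L"
    using recolours_proper[OF d'] recolours_image[OF d'] c by auto
  have "card (L - d ` A) = card L - card (p ` A)"
    using card_Diff_subset[of "d ` A" L] pd(2) same_kernel_card[OF d(2)] assms(1) by auto
  then have "card (p' ` B) < card (L - d ` A)" using L(1) by simp
  moreover have "d ` B \<subseteq> L - d ` A" using pd(2) sep[OF pd(1)] by blast
  ultimately obtain e where e: "recolours B (L - d ` A) m' d e" "same_kernel B e p'"
    using canonical_recolours[OF B, of "L - d ` A" d] c(1) proper_on_subset[OF pd(1), of B] by auto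
  have "recolours (A \<union> B) L m' d e" by (rule recolours_lift[OF e(1)]) auto
  from recolours_trans[OF this d'] have "recolours (A \<union> B) L (m + m') c e" .
  moreover have "e a = d a" if "a \<in> A" for a
    using recolours_outside[OF e(1)] that assms(3) by blast
  then have "same_kernel A e p" using same_kernel_cong[OF d(2)] by simp
  ultimately show thesis using e(2) that by blast
qed

lemma canonical_join:
  assumes "finite A" "finite B" "A \<inter> B = {}" "\<And>a b. a \<in> A \<Longrightarrow> b \<in> B \<Longrightarrow> E a b"
    and A: "canonical A m p" and B: "canonical B m' p'"
  obtains q where "canonical (A \<union> B) (m + m') q" "same_kernel A q p"
proof -
  \<comment> \<open>Even and odd labels keep the colours of the two parts apart, as every proper
    colouring of a join must.\<close>
  define q where "q u = (if u \<in> A then 2 * p u else 2 * p' u + 1)" for u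
  have neq: "q a \<noteq> q b" if "a \<in> A" "b \<in> B" for a b
    using that assms(3) unfolding q_def by (auto; presburger)
  have kA: "same_kernel A q p" and kB: "same_kernel B q p'"
    using assms(3) by (auto simp: same_kernel_def q_def)
  have card_q: "card (q ` (A \<union> B)) = card (p ` A) + card (p' ` B)"
    using card_image_join[OF assms(1,2) neq] same_kernel_card[OF kA] same_kernel_card[OF kB] by simp
  have "canonical (A \<union> B) (m + m') q"
  proof (rule canonicalI)
    have "proper_on A q" "proper_on B q"
      using proper_on_cong_kernel[OF kA] proper_on_cong_kernel[OF kB] canonical_proper[OF A]
        canonical_proper[OF B] by auto
    then show "proper_on (A \<union> B) q"
      using neq unfolding proper_on_def by (metis UnE)
    show "card (q ` (A \<union> B)) \<le> card (r ` (A \<union> B))" if r: "proper_on (A \<union> B) r" for r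
    proof -
      have "card (r ` (A \<union> B)) = card (r ` A) + card (r ` B)"
        using r assms(4) by (intro card_image_join assms(1,2)) (auto simp: proper_on_def)
      then show ?thesis
        using card_q canonical_le[OF A, of r] canonical_le[OF B, of r]
          proper_on_subset[OF r, of A] proper_on_subset[OF r, of B] by auto
    qed
    fix L c
    assume c: "finite L" "proper_on (A \<union> B) c" "c ` (A \<union> B) \<subseteq> L" "card (q ` (A \<union> B)) < card L"
    then have L: "card (p ` A) + card (p' ` B) < card L" by (simp add: card_q)
    have "\<exists>e. recolours (A \<union> B) L (m + m') c e \<and> same_kernel A e p \<and> same_kernel B e p'"
    proof (cases "card (p ` A) < card (L - c ` B)")
      case True
      then show ?thesis
        using join_recolours[OF assms(1-3) _ A B c(1-3) L] assms(4) by metis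
    next
      case False
      have "card (L - c ` B) = card L - card (c ` B)"
        using c(3) assms(2) by (intro card_Diff_subset) auto
      with False L have "card (p' ` B) < card (c ` B)" by linarith
      also have "\<dots> \<le> card (L - c ` A)"
      proof (rule card_mono)
        show "c ` B \<subseteq> L - c ` A"
          using c(3) proper_onD[OF c(2) _ _ assms(4)] by fastforce
      qed (use c(1) in simp)
      finally have "card (p' ` B) < card (L - c ` A)" .
      then show ?thesis
        using join_recolours[of B A m' p' m p L c] assms(1-3) sym[OF assms(4)] A B c L
        by (metis Int_commute Un_commute add.commute)
    qed
    then obtain e where e: "recolours (A \<union> B) L (m + m') c e" "same_kernel A e p"
      "same_kernel B e p'" by blast
    have "same_kernel (A \<union> B) e q"
    proof (rule same_kernel_Un)
      show "same_kernel A e q" "same_kernel B e q"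
        using e kA kB by (auto simp: same_kernel_def)
      show "e a = e b \<longleftrightarrow> q a = q b" if "a \<in> A" "b \<in> B" for a b
        using neq[OF that] assms(4)[OF that] recolours_proper[OF e(1) c(2)] that
        by (auto simp: proper_on_def)
    qed
    with e(1) show "\<exists>d. recolours (A \<union> B) L (m + m') c d \<and> same_kernel (A \<union> B) d q" by blast
  qed
  then show thesis using kA by (rule that)
qed

section \<open>Disjoint unions of cliques\<close>

text \<open>There are no edges to \<open>A\<close>, so \<open>A\<close> reaches its partition first
  while \<open>K\<close> stands still. Afterwards \<open>K\<close> only has to be aligned: its
  vertices join distinct classes of \<open>A\<close>, and since \<open>K\<close> is a clique this is
  a mere renaming of singleton classes, at a cost of 3/2 per vertex. The bound on
  \<open>card K\<close> provides the classes to join and leaves a spare colour for the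
  renaming.\<close>

lemma canonical_add_clique:
  assumes "finite A" "finite K" "A \<inter> K = {}" "\<And>a b. a \<in> A \<Longrightarrow> b \<in> K \<Longrightarrow> \<not> E a b"
    and clique: "\<And>u v. u \<in> K \<Longrightarrow> v \<in> K \<Longrightarrow> u \<noteq> v \<Longrightarrow> E u v"
    and A: "canonical A m p" and le: "card K \<le> card (p ` A)"
  obtains q where "canonical (A \<union> K) (m + 3 * card K div 2) q"
proof -
  obtain g where g: "g ` K \<subseteq> p ` A" "inj_on g K"
    using card_le_inj[OF assms(2) _ le] assms(1) by blast
  then have "\<forall>v\<in>K. \<exists>u. u \<in> A \<and> p u = g v" by force
  \<comment> \<open>\<open>r v\<close> is a vertex of \<open>A\<close> in the class that
    \<open>v\<close> is to join; it names the class independently of its later colour.\<close>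
  then obtain r where r: "\<And>v. v \<in> K \<Longrightarrow> r v \<in> A \<and> p (r v) = g v" by metis
  define q where "q u = (if u \<in> A then p u else g u)" for u
  have qK: "q v = g v" if "v \<in> K" for v using that assms(3) by (auto simp: q_def)
  have img: "q ` (A \<union> K) = p ` A" using g qK by (auto simp: q_def image_iff)
  have "canonical (A \<union> K) (m + 3 * card K div 2) q"
  proof (rule canonicalI)
    show "proper_on (A \<union> K) q"
      unfolding proper_on_def
    proof (intro ballI impI)
      fix u v assume uv: "u \<in> A \<union> K" "v \<in> A \<union> K" "E u v"
      then consider "u \<in> A" "v \<in> A" | "u \<in> K" "v \<in> K"
        using assms(4) sym by blast
      then show "q u \<noteq> q v"
      proof cases
        case 1
        then show ?thesis using canonical_proper[OF A] uv(3) by (simp add: q_def proper_on_def)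
      next
        case 2
        then show ?thesis using g(2) uv(3) irrefl by (auto simp: qK inj_on_def)
      qed
    qed
    show "card (q ` (A \<union> K)) \<le> card (s ` (A \<union> K))" if "proper_on (A \<union> K) s" for s
    proof -
      have "card (p ` A) \<le> card (s ` A)"
        using canonical_le[OF A] proper_on_subset[OF that] by blast
      also have "\<dots> \<le> card (s ` (A \<union> K))" using assms(1,2) by (intro card_mono) auto
      finally show ?thesis by (simp add: img)
    qed
    fix L c
    assume c: "finite L" "proper_on (A \<union> K) c" "c ` (A \<union> K) \<subseteq> L" "card (q ` (A \<union> K)) < card L"
    have L: "card (p ` A) < card L" using c(4) by (simp only: img)
    obtain d where d: "recolours A L m c d" "same_kernel A d p"
      using canonical_recolours[OF A c(1) proper_on_subset[OF c(2)] _ L] c(3) by auto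
    have d': "recolours (A \<union> K) L m c d"
      using assms(4) by (intro recolours_lift[OF d(1)]) auto
    have pd: "proper_on (A \<union> K) d" "d ` (A \<union> K) \<subseteq> L"
      using recolours_proper[OF d'] recolours_image[OF d'] c by auto
    define b where "b v = d (r v)" for v
    have injb: "inj_on b K"
      using d(2) r g(2) unfolding inj_on_def b_def same_kernel_def by metis
    have "inj_on d K" using proper_on_inj_clique[OF pd(1)] clique by blast
    then have ker: "same_kernel K d b" using injb by (rule same_kernel_inj)
    have bL: "b ` K \<subseteq> L" using r pd(2) by (auto simp: b_def)
    have "card (b ` K) < card L" using card_image[OF injb] le L by simp
    then have e: "recolours K L (3 * card K div 2) d (\<lambda>v. if v \<in> K then b v else d v)"
      using rename[OF assms(2) c(1) bL _ proper_on_subset[OF pd(1)] ker] pd(2) by auto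
    let ?e = "\<lambda>v. if v \<in> K then b v else d v"
    have "recolours (A \<union> K) L (3 * card K div 2) d ?e"
      using assms(4) sym by (intro recolours_lift[OF e]) auto
    from recolours_trans[OF this d']
    have "recolours (A \<union> K) L (m + 3 * card K div 2) c ?e" .
    moreover have "same_kernel (A \<union> K) ?e q"
    proof (rule same_kernel_Un)
      have eA: "?e a = d a" if "a \<in> A" for a using that assms(3) by auto
      show "same_kernel A ?e q"
        by (rule same_kernel_cong[OF d(2) eA]) (auto simp: q_def)
      show "same_kernel K ?e q"
        by (rule same_kernel_cong[OF same_kernel_inj[OF injb g(2)]]) (auto simp: qK)
      show "?e u = ?e v \<longleftrightarrow> q u = q v" if "u \<in> A" "v \<in> K" for u v
      proof -
        have "?e u = ?e v \<longleftrightarrow> d u = d (r v)" using eA[OF that(1)] that(2) by (simp add: b_def)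
        also have "\<dots> \<longleftrightarrow> p u = p (r v)" using d(2) r that by (auto simp: same_kernel_def)
        also have "\<dots> \<longleftrightarrow> q u = q v" using qK r that by (simp add: q_def)
        finally show ?thesis .
      qed
    qed
    ultimately show "\<exists>d. recolours (A \<union> K) L (m + 3 * card K div 2) c d \<and> same_kernel (A \<union> K) d q"
      by blast
  qed
  then show thesis by (rule that)
qed

text \<open>A smallest clique component is split off. Another component inside the remainder is at
  least as large, so the remainder needs at least as many colours as the removed clique, as
  \<open>canonical_add_clique\<close> demands. The bound is doubled so that the rounded halves add
  up without loss.\<close>

lemma canonical_cluster:
  assumes "finite U"
    and "\<And>x y z. x \<in> U \<Longrightarrow> y \<in> U \<Longrightarrow> z \<in> U \<Longrightarrow> E x y \<Longrightarrow> E y z \<Longrightarrow> x \<noteq> z \<Longrightarrow> E x z"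
  shows "\<exists>m p. 2 * m \<le> 3 * card U \<and> canonical U m p"
  using assms
proof (induction U rule: finite_psubset_induct)
  case (psubset U)
  show ?case
  proof (cases "U = {}")
    case True
    obtain p where "canonical U 0 p" using canonical_clique[of U] True by auto
    then show ?thesis by (intro exI[of _ 0]) auto
  next
    case False
    define N where "N x = {y \<in> U. y = x \<or> E x y}" for x
    obtain x where x: "x \<in> U" "\<And>y. y \<in> U \<Longrightarrow> card (N x) \<le> card (N y)"
      using ex_has_least_nat[of "\<lambda>x. x \<in> U" _ "\<lambda>x. card (N x)"] False by blast
    have clique: "E u v" if "y \<in> U" "u \<in> N y" "v \<in> N y" "u \<noteq> v" for y u v
      using psubset.prems[of u y v] that sym[of y u] by (auto simp: N_def)
    have fin: "finite (N y)" "N y \<subseteq> U" for y using psubset.hyps by (auto simp: N_def)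
    show ?thesis
    proof (cases "U = N x")
      case True
      obtain p where "canonical U 0 p"
        using canonical_clique[of "N x"] clique[OF x(1)] fin True by auto
      then show ?thesis by (intro exI[of _ 0]) auto
    next
      case False
      have xN: "x \<in> N x" using x by (auto simp: N_def)
      then have "U - N x \<subset> U" using x(1) by blast
      then obtain m p where m: "2 * m \<le> 3 * card (U - N x)" "canonical (U - N x) m p"
        using psubset.IH[of "U - N x"] psubset.prems by (metis Diff_iff)
      obtain y where y: "y \<in> U" "y \<notin> N x" using False fin by blast
      have sub: "N y \<subseteq> U - N x"
      proof
        fix z assume z: "z \<in> N y"
        then have "z \<notin> N x"
          using psubset.prems[of x z y] x(1) y sym[of y z] sym[of x y] by (auto simp: N_def)
        with z show "z \<in> U - N x" using fin(2) by blast
      qed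
      have none: "\<not> E u v" if "u \<in> U - N x" "v \<in> N x" for u v
        using psubset.prems[of x v u] x(1) that sym[of u v] by (auto simp: N_def)
      have "inj_on p (N y)"
        using proper_on_inj_clique[OF canonical_proper[OF m(2)] sub] clique[OF y(1)] by blast
      then have "card (N y) = card (p ` N y)" by (simp add: card_image)
      also have "\<dots> \<le> card (p ` (U - N x))" using sub psubset.hyps by (intro card_mono) auto
      finally have le: "card (N x) \<le> card (p ` (U - N x))" using x(2)[OF y(1)] by simp
      have "finite (U - N x)" "(U - N x) \<inter> N x = {}" using psubset.hyps by auto
      then obtain q where "canonical ((U - N x) \<union> N x) (m + 3 * card (N x) div 2) q"
        using canonical_add_clique[OF _ fin(1) _ none clique[OF x(1)] m(2) le] by blast
      moreover have "(U - N x) \<union> N x = U" using fin(2) by blast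
      moreover have "card (U - N x) + card (N x) = card U"
        using card_Diff_subset[OF fin] card_mono[OF psubset.hyps fin(2)] by simp
      ultimately show ?thesis using m(1) by (intro exI[of _ "m + 3 * card (N x) div 2"]) auto
    qed
  qed
qed

section \<open>Independence number two\<close>

text \<open>Every fibre has one or two elements. If a vertex alone in its fibre has weight 2 and
  every other vertex weight 1, each fibre weighs exactly 2.\<close>

lemma card_singleton_fibres:
  fixes f :: "'a \<Rightarrow> nat"
  assumes "finite U"
    and "\<And>x y z. x \<in> U \<Longrightarrow> y \<in> U \<Longrightarrow> z \<in> U \<Longrightarrow> f x = f y \<Longrightarrow> f y = f z \<Longrightarrow> x = y \<or> y = z \<or> x = z"
  shows "card U + card {x \<in> U. \<forall>y \<in> U. f y = f x \<longrightarrow> y = x} = 2 * card (f ` U)"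
proof -
  let ?P = "\<lambda>x. \<forall>y \<in> U. f y = f x \<longrightarrow> y = x"
  let ?g = "\<lambda>x. 1 + (if ?P x then 1 else 0) :: nat"
  have "card U + card {x \<in> U. ?P x} = sum ?g U"
    using assms(1) by (subst sum.distrib) (simp add: sum.If_cases Int_def)
  also have "\<dots> = (\<Sum>a \<in> f ` U. sum ?g {x \<in> U. f x = a})"
    using assms(1) by (rule sum.image_gen)
  also have "\<dots> = (\<Sum>a \<in> f ` U. 2)"
  proof (rule sum.cong)
    fix a assume "a \<in> f ` U"
    then obtain x where x: "x \<in> U" "a = f x" by blast
    show "sum ?g {x \<in> U. f x = a} = 2"
    proof (cases "?P x")
      case True
      then have "{x \<in> U. f x = a} = {x}" unfolding x(2) using x(1) by blast
      then have "sum ?g {x \<in> U. f x = a} = ?g x" by simp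
      with True show ?thesis by simp
    next
      case False
      then obtain y where y: "y \<in> U" "f y = f x" "y \<noteq> x" by blast
      have "z = x \<or> z = y" if "z \<in> U" "f z = f x" for z
        using assms(2)[of x y z] x(1) y that by auto
      then have "{x \<in> U. f x = a} = {x, y}"
        unfolding x(2) using x(1) y(1,2) by blast
      then have "sum ?g {x \<in> U. f x = a} = ?g x + ?g y" using y(3) by simp
      moreover have "\<not> ?P y" using x y by metis
      ultimately show ?thesis using False by simp
    qed
  qed simp
  finally show ?thesis by simp
qed

text \<open>On \<open>U\<close> the colouring \<open>c\<close> factors through \<open>p\<close>. As
  \<open>p\<close> has no more values than \<open>c\<close>, the factor \<open>h\<close> is
  injective.\<close>

lemma same_kernel_coarser:
  assumes "finite U" "\<And>u v. u \<in> U \<Longrightarrow> v \<in> U \<Longrightarrow> p u = p v \<Longrightarrow> c u = c v"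
    and "card (p ` U) \<le> card (c ` U)"
  shows "same_kernel U c p"
proof -
  define h where "h x = c (SOME u. u \<in> U \<and> p u = x)" for x
  have h: "h (p u) = c u" if "u \<in> U" for u
  proof -
    have w: "(SOME w. w \<in> U \<and> p w = p u) \<in> U \<and> p (SOME w. w \<in> U \<and> p w = p u) = p u"
      using that by (intro someI[of "\<lambda>w. w \<in> U \<and> p w = p u" u]) auto
    show ?thesis unfolding h_def by (rule assms(2)[OF conjunct1[OF w] that conjunct2[OF w]])
  qed
  have img: "h ` (p ` U) = c ` U" using h by (auto simp: image_image)
  then have "card (h ` (p ` U)) = card (p ` U)"
    using card_image_le[of "p ` U" h] assms(1,3) by simp
  then have "inj_on h (p ` U)" using assms(1) by (intro eq_card_imp_inj_on) auto
  then show ?thesis unfolding same_kernel_def using h assms(2) by (metis imageI inj_onD)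
qed

text \<open>
  Both the given and the optimal colouring are matchings in the complement. Without a spare colour
  the given one is the smaller matching, so it leaves a vertex \<open>x\<close> single that the optimal one
  matches, and the partner of \<open>x\<close> can be moved to \<open>x\<close>.
\<close>

lemma canonical_3K1_free:
  assumes "finite U"
    and tri: "\<And>x y z. x \<in> U \<Longrightarrow> y \<in> U \<Longrightarrow> z \<in> U \<Longrightarrow> x \<noteq> y \<Longrightarrow> y \<noteq> z \<Longrightarrow> x \<noteq> z \<Longrightarrow>
      E x y \<or> E y z \<or> E x z"
  obtains p where "canonical U (card U) p"
proof -
  obtain p where p: "proper_on U p" "\<And>q. proper_on U q \<Longrightarrow> card (p ` U) \<le> card (q ` U)"
    using minimal_proper[OF assms(1)] by blast
  \<comment> \<open>The vertices separated by \<open>c\<close> from their partner in the matching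
    given by \<open>p\<close>. Each round takes one matched pair out of this set and spends two
    steps on it.\<close>
  define B where "B c = {x \<in> U. \<exists>y \<in> U. y \<noteq> x \<and> p y = p x \<and> c y \<noteq> c x}" for c :: "'a \<Rightarrow> nat"
  have finB: "finite (B c)" for c using assms(1) by (simp add: B_def)
  have two: "x = y \<or> y = z \<or> x = z"
    if "proper_on U f" "x \<in> U" "y \<in> U" "z \<in> U" "f x = f y" "f y = f z" for f x y z
    using tri[OF that(2-4)] that unfolding proper_on_def by metis
  have main: "\<exists>d. recolours U L (card (B c)) c d \<and> same_kernel U d p"
    if "finite L" "card (p ` U) < card L" "proper_on U c" "c ` U \<subseteq> L" for L c
    using that(3,4)
  proof (induction "card (B c)" arbitrary: c rule: less_induct)
    case less
    show ?case
    proof (cases "B c = {}")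
      case True
      then have "same_kernel U c p"
        using p(2)[OF less.prems(1)] assms(1) by (intro same_kernel_coarser) (auto simp: B_def)
      then show ?thesis using recolours.refl by blast
    next
      case ne: False
      have "\<exists>x y f. x \<in> U \<and> y \<in> U \<and> x \<noteq> y \<and> p y = p x \<and> c y \<noteq> c x \<and> f \<in> L \<and> f \<notin> c ` (U - {x, y})"
      proof (cases "L \<subseteq> c ` U")
        case False
        then show ?thesis using ne unfolding B_def by fast
      next
        case True
        let ?S = "\<lambda>f. {x \<in> U. \<forall>y \<in> U. f y = f x \<longrightarrow> y = x}"
        have "card (p ` U) < card (c ` U)" using True less.prems that(2) by (metis subset_antisym)
        moreover have "card U + card (?S f) = 2 * card (f ` U)" if "proper_on U f" for f
          by (rule card_singleton_fibres[OF assms(1)]) (rule two[OF that])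
        from this[OF p(1)] this[OF less.prems(1)]
        have "card U + card (?S p) = 2 * card (p ` U)" "card U + card (?S c) = 2 * card (c ` U)" .
        ultimately have "\<not> card (?S c) \<le> card (?S p)" by linarith
        then have "\<not> ?S c \<subseteq> ?S p"
          using card_mono[of "?S p" "?S c"] assms(1) by auto
        then obtain x y where "x \<in> ?S c" "y \<in> U" "p y = p x" "y \<noteq> x" by blast
        \<comment> \<open>The common colour is \<open>c x\<close>, which no other vertex has. The
          vertex \<open>x\<close> is counted as moved although it keeps its colour.\<close>
        then show ?thesis
          using less.prems(2) by (intro exI[of _ x] exI[of _ y] exI[of _ "c x"]) auto
      qed
      then obtain x y f where xy: "x \<in> U" "y \<in> U" "x \<noteq> y" "p y = p x" "c y \<noteq> c x"
        and f: "f \<in> L" "f \<notin> c ` (U - {x, y})" by blast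
      have ind: "\<not> E u v" if "u \<in> {x, y}" "v \<in> {x, y}" for u v
        using that xy proper_onD[OF p(1), of u v] irrefl[of u] by auto
      define c' where "c' = (\<lambda>v. if v \<in> {x, y} then f else c v)"
      have r: "recolours U L (card {x, y}) c c'"
        unfolding c'_def using xy f ind by (intro recolours_gather) auto
      have np: "p u \<noteq> p x" if "u \<in> U" "u \<notin> {x, y}" for u
        using two[OF p(1) that(1) xy(1,2) _ xy(4)[symmetric]] that(2) xy(3) by auto
      \<comment> \<open>A class of \<open>p\<close> has at most two members, so the pair
        \<open>x\<close>, \<open>y\<close> is a full class and no other pair is affected.\<close>
      have B': "B c' = B c - {x, y}"
      proof (intro equalityI subsetI)
        fix u assume "u \<in> B c'"
        then obtain w where w: "u \<in> U" "w \<in> U" "w \<noteq> u" "p w = p u" "c' w \<noteq> c' u"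
          by (auto simp: B_def)
        have "v \<in> {x, y} \<longleftrightarrow> p v = p x" if "v \<in> U" for v
          using np[of v] that xy(4) by auto
        then have "u \<in> {x, y} \<longleftrightarrow> w \<in> {x, y}" using w(1,2,4) by metis
        with w(5) have "u \<notin> {x, y}" "w \<notin> {x, y}" unfolding c'_def by metis+
        with w show "u \<in> B c - {x, y}" by (auto simp: B_def c'_def)
      next
        fix u assume u: "u \<in> B c - {x, y}"
        then obtain w where w: "u \<in> U" "w \<in> U" "w \<noteq> u" "p w = p u" "c w \<noteq> c u"
          by (auto simp: B_def)
        then have "w \<notin> {x, y}" using np[of u] u xy(4) by auto
        with w u show "u \<in> B c'" by (auto simp: B_def c'_def)
      qed
      have sub: "{x, y} \<subseteq> B c" using xy by (auto simp: B_def)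
      then have card: "card (B c') + card {x, y} = card (B c)"
        unfolding B' using card_Diff_subset[OF _ sub] card_mono[OF finB sub] by simp
      moreover have "card {x, y} > 0" by (simp add: card_gt_0_iff)
      ultimately obtain d where "recolours U L (card (B c')) c' d" "same_kernel U d p"
        using less.hyps[of c'] recolours_proper[OF r less.prems(1)]
          recolours_image[OF r less.prems(2)] by auto
      then show ?thesis using recolours_trans[OF _ r] card by (metis add.commute)
    qed
  qed
  have "canonical U (card U) p"
  proof (rule canonicalI[OF p])
    fix L c
    assume c: "finite L" "proper_on U c" "c ` U \<subseteq> L" "card (p ` U) < card L"
    then obtain d where "recolours U L (card (B c)) c d" "same_kernel U d p"
      using main by blast
    moreover have "card (B c) \<le> card U" using assms(1) by (intro card_mono) (auto simp: B_def)
    ultimately show "\<exists>d. recolours U L (card U) c d \<and> same_kernel U d p"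
      using recolours_mono by blast
  qed
  then show thesis by (rule that)
qed

section \<open>Excluding \<open>P\<^sub>3 + P\<^sub>1\<close>\<close>

text \<open>
  A maximal \<open>P\<^sub>3\<close>-free set containing three independent vertices is complete to the remaining vertices.
\<close>

lemma canonical_P3_P1_free:
  assumes "finite V"
    and "\<And>a b c d. a \<in> V \<Longrightarrow> b \<in> V \<Longrightarrow> c \<in> V \<Longrightarrow> d \<in> V \<Longrightarrow> a \<noteq> c \<Longrightarrow> E a b \<Longrightarrow> E b c \<Longrightarrow> \<not> E a c \<Longrightarrow>
      E d a \<or> E d b \<or> E d c"
  shows "\<exists>m p. 2 * m \<le> 3 * card V \<and> canonical V m p"
  using assms
proof (induction V rule: finite_psubset_induct)
  case (psubset V)
  have free: "E d a \<or> E d b \<or> E d c" if "a \<in> V" "b \<in> V" "c \<in> V" "d \<in> V" "a \<noteq> c" "E a b" "E b c" "\<not> E a c" for a b c d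
    using psubset.prems that by blast
  show ?case
  proof (cases "\<exists>a b c. a \<in> V \<and> b \<in> V \<and> c \<in> V \<and> a \<noteq> b \<and> b \<noteq> c \<and> a \<noteq> c \<and> \<not> E a b \<and> \<not> E b c \<and> \<not> E a c")
    case False
    then obtain p where "canonical V (card V) p"
      using canonical_3K1_free[OF psubset.hyps] by metis
    then show ?thesis by (intro exI[of _ "card V"]) auto
  next
    case True
    then obtain a b c where abc: "a \<in> V" "b \<in> V" "c \<in> V" "a \<noteq> b" "b \<noteq> c" "a \<noteq> c"
      "\<not> E a b" "\<not> E b c" "\<not> E a c" by blast
    \<comment> \<open>This expresses that \<open>S\<close> induces a disjoint union of
      cliques.\<close>
    define cluster where
      "cluster S \<longleftrightarrow> (\<forall>x\<in>S. \<forall>y\<in>S. \<forall>z\<in>S. E x y \<longrightarrow> E y z \<longrightarrow> x \<noteq> z \<longrightarrow> E x z)" for S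
    let ?F = "{S. S \<subseteq> V \<and> cluster S \<and> {a, b, c} \<subseteq> S}"
    have "cluster {a, b, c}" using abc sym by (auto simp: cluster_def)
    then have "{a, b, c} \<in> ?F" using abc by auto
    then have "?F \<noteq> {}" by (rule ex_in_conv[THEN iffD1, OF exI])
    moreover have "finite ?F"
      by (rule finite_subset[of _ "Pow V"]) (use psubset.hyps in auto)
    ultimately obtain S where SF: "S \<in> ?F" and "\<forall>T \<in> ?F. S \<subseteq> T \<longrightarrow> S = T"
      using finite_has_maximal[of ?F] by auto
    then have max: "S = T" if "T \<in> ?F" "S \<subseteq> T" for T using that by blast
    have S: "S \<subseteq> V" "cluster S" "{a, b, c} \<subseteq> S" using SF by auto
    have trans: "E x z" if "x \<in> S" "y \<in> S" "z \<in> S" "E x y" "E y z" "x \<noteq> z" for x y z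
      using S(2) that unfolding cluster_def by blast
    have complete: "E s v" if s: "s \<in> S" and v: "v \<in> V - S" for s v
    proof (rule ccontr)
      assume sv: "\<not> E s v"
      have inV: "x \<in> V" if "x \<in> S" for x using that S by blast
      have "insert v S \<notin> ?F" using max[of "insert v S"] v by blast
      then have "\<not> cluster (insert v S)" using S v by blast
      then obtain x y z where xyz: "x \<in> insert v S" "y \<in> insert v S" "z \<in> insert v S"
        "E x y" "E y z" "x \<noteq> z" "\<not> E x z" unfolding cluster_def by blast
      \<comment> \<open>By maximality of \<open>S\<close> there is an induced path on three vertices
        through \<open>v\<close>, either with \<open>v\<close> in the middle or with
        \<open>v\<close> at an end.\<close>
      then consider (mid) "y = v" "x \<in> S" "z \<in> S" | (end1) "x = v" "y \<in> S" "z \<in> S"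
        | (end2) "z = v" "y \<in> S" "x \<in> S"
        using irrefl[of v] trans[of x y z] by blast
      then show False
      proof cases
        case mid
        \<comment> \<open>The cliques of \<open>x\<close> and \<open>z\<close> contain at most two
          of the independent vertices \<open>a\<close>, \<open>b\<close>, \<open>c\<close>; a third
          one gives \<open>w\<close>, which must see \<open>v\<close>. So \<open>v\<close> has
          neighbours in three cliques, \<open>s\<close> misses at least two of these neighbours, and
          together with \<open>v\<close> these two form a path that \<open>s\<close> does not
          see.\<close>
        have "\<exists>w \<in> {a, b, c}. w \<noteq> x \<and> w \<noteq> z \<and> \<not> E w x \<and> \<not> E w z"
        proof (rule ccontr)
          assume "\<not> ?thesis"
          then have near: "w = x \<or> w = z \<or> E w x \<or> E w z" if "w \<in> {a, b, c}" for w
            using that by blast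
          have close: "u = w \<or> E u w" if "u \<in> S" "w \<in> S" "t \<in> S" "u = t \<or> E u t" "w = t \<or> E w t" for u w t
            using trans[of u t w] that sym[of u t] sym[of w t] sym[of w u] by blast
          show False
            using near[of a] near[of b] near[of c] close[of a b x] close[of a b z] close[of b c x]
              close[of b c z] close[of a c x] close[of a c z] abc S(3) mid by auto
        qed
        then obtain w where w: "w \<in> S" "w \<noteq> x" "w \<noteq> z" "\<not> E w x" "\<not> E w z"
          using S(3) by blast
        have xv: "E x v" "E v z" using xyz mid by auto
        have wv: "E w v"
          using free[of x v z w] w mid xyz v inV by auto
        have key: False if "u \<in> S" "t \<in> S" "u \<noteq> t" "\<not> E u t" "E u v" "E v t" "\<not> E s u" "\<not> E s t" for u t
          using free[of u v t s] that inV v s sv by auto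
        have far: "E s u \<Longrightarrow> E s t \<Longrightarrow> u \<noteq> t \<Longrightarrow> u \<in> S \<Longrightarrow> t \<in> S \<Longrightarrow> E u t" for u t
          using trans[of u s t] sym[of s u] s by blast
        show False
          using key[of x z] key[of x w] key[of w z] far[of x z] far[of x w] far[of w z]
            xv wv w(1-3) w(4,5) mid xyz(6,7) sym[OF xv(2)] sym[OF wv] sym[of v w] sym[of w z] sym[of x w]
          by blast
      next
        case end1
        \<comment> \<open>\<open>P\<close> describes the vertices of \<open>S\<close> outside the
          clique of \<open>y\<close> and \<open>z\<close>. They miss \<open>y\<close> and
          \<open>z\<close>, so the path \<open>v\<close>, \<open>y\<close>, \<open>z\<close> forces
          them to see \<open>v\<close>. Two independent ones exist, and with \<open>v\<close>
          between them they form a path that \<open>z\<close> does not see.\<close>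
        define P where "P w \<longleftrightarrow> w \<in> S \<and> \<not> E w y \<and> w \<noteq> y" for w
        have vz: "\<not> E z v" "E v y" using xyz end1 sym[of z v] by auto
        have P: "E w v \<and> \<not> E w z \<and> w \<noteq> z" if "P w" for w
        proof -
          have "w \<noteq> z" "\<not> E w z"
            using that xyz(5) sym[OF xyz(5)] trans[of w z y] end1 unfolding P_def by blast+
          moreover have "E w v"
            using free[of v y z w] that xyz end1 calculation inV v unfolding P_def by blast
          ultimately show ?thesis by blast
        qed
        have "\<exists>u t. P u \<and> P t \<and> u \<noteq> t \<and> \<not> E u t"
        proof -
          have close: "P u \<or> P w" if "u \<in> S" "w \<in> S" "u \<noteq> w" "\<not> E u w" for u w
            using trans[of u y w] that sym[of w y] end1 unfolding P_def by blast
          show ?thesis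
            using close[of a b] close[of b c] close[of a c] abc S(3) by blast
        qed
        then obtain u t where ut: "P u" "P t" "u \<noteq> t" "\<not> E u t" by blast
        then show False
          using free[of u v t z] P[OF ut(1)] P[OF ut(2)] vz(1) inV v end1
            sym[of z u] sym[of z t] sym[of t v] unfolding P_def by blast
      next
        case end2
        define P where "P w \<longleftrightarrow> w \<in> S \<and> \<not> E w y \<and> w \<noteq> y" for w
        have vz: "\<not> E x v" "E v y" "E y x" using xyz end2 sym[of y v] sym[of x y] by auto
        have P: "E w v \<and> \<not> E w x \<and> w \<noteq> x" if "P w" for w
        proof -
          have "w \<noteq> x" "\<not> E w x"
            using that xyz(4) trans[of w x y] end2 unfolding P_def by blast+
          moreover have "E w v"
            using free[of x y v w] that xyz end2 calculation inV v unfolding P_def by blast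
          ultimately show ?thesis by blast
        qed
        have "\<exists>u t. P u \<and> P t \<and> u \<noteq> t \<and> \<not> E u t"
        proof -
          have close: "P u \<or> P w" if "u \<in> S" "w \<in> S" "u \<noteq> w" "\<not> E u w" for u w
            using trans[of u y w] that sym[of w y] end2 unfolding P_def by blast
          show ?thesis
            using close[of a b] close[of b c] close[of a c] abc S(3) by blast
        qed
        then obtain u t where ut: "P u" "P t" "u \<noteq> t" "\<not> E u t" by blast
        then show False
          using free[of u v t x] P[OF ut(1)] P[OF ut(2)] vz(1) inV v end2
            sym[of x u] sym[of x t] sym[of t v] unfolding P_def by blast
      qed
    qed
    have finS: "finite S" using S(1) psubset.hyps finite_subset by blast
    have "\<exists>m p. 2 * m \<le> 3 * card S \<and> canonical S m p"
      by (rule canonical_cluster[OF finS]) (rule trans)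
    then obtain m p where m: "2 * m \<le> 3 * card S" "canonical S m p" by blast
    have "V - S \<subset> V" using S(3) abc(1) by blast
    then obtain m' p' where m': "2 * m' \<le> 3 * card (V - S)" "canonical (V - S) m' p'"
      using psubset.IH[of "V - S"] free by (metis Diff_iff)
    obtain q where "canonical (S \<union> (V - S)) (m + m') q"
      by (rule canonical_join[OF finS _ _ _ m(2) m'(2)]) (use psubset.hyps complete in auto)
    moreover have "S \<union> (V - S) = V" using S(1) by blast
    moreover have "card S + card (V - S) = card V"
      using card_Diff_subset[OF finS S(1)] card_mono[OF psubset.hyps S(1)] by simp
    ultimately show ?thesis using m(1) m'(1) by (intro exI[of _ "m + m'"]) auto
  qed
qed

section \<open>Excluding \<open>2K\<^sub>2\<close> and \<open>C\<^sub>4\<close>\<close>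

text \<open>Each \<open>v\<close> in \<open>I\<close> takes the current colour of a non-neighbour
  \<open>r v\<close> in \<open>K\<close>. The neighbours of \<open>v\<close> all lie in
  \<open>K\<close>, whose colours are distinct, so that colour is free for \<open>v\<close>. The
  number of classes is that of \<open>K\<close>, which no proper colouring can undercut.\<close>

lemma canonical_split:
  assumes "finite K" "finite I" "K \<inter> I = {}"
    and clique: "\<And>u v. u \<in> K \<Longrightarrow> v \<in> K \<Longrightarrow> u \<noteq> v \<Longrightarrow> E u v"
    and ind: "\<And>u v. u \<in> I \<Longrightarrow> v \<in> I \<Longrightarrow> \<not> E u v"
    and miss: "\<And>v. v \<in> I \<Longrightarrow> \<exists>k \<in> K. \<not> E v k"
  obtains p where "canonical (K \<union> I) (card I) p"
proof -
  obtain g :: "'a \<Rightarrow> nat" where g: "inj_on g K"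
    using assms(1) finite_imp_inj_to_nat_seg by metis
  obtain r where r: "\<And>v. v \<in> I \<Longrightarrow> r v \<in> K \<and> \<not> E v (r v)" using miss by metis
  define \<rho> where "\<rho> v = (if v \<in> I then r v else v)" for v
  have \<rho>: "\<rho> v \<in> K" if "v \<in> K \<union> I" for v using that r by (auto simp: \<rho>_def)
  have \<rho>K: "\<rho> v = v" if "v \<in> K" for v using that assms(3) by (auto simp: \<rho>_def)
  have img: "(\<lambda>v. g (\<rho> v)) ` (K \<union> I) = g ` K"
    using \<rho> \<rho>K by (force simp: image_iff)
  have "canonical (K \<union> I) (card I) (\<lambda>v. g (\<rho> v))"
  proof (rule canonicalI)
    show "proper_on (K \<union> I) (\<lambda>v. g (\<rho> v))"
      unfolding proper_on_def
    proof (intro ballI impI)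
      fix u v assume uv: "u \<in> K \<union> I" "v \<in> K \<union> I" "E u v"
      have "\<rho> u \<noteq> \<rho> v"
        using uv ind[of u v] r[of u] r[of v] irrefl[of u] sym[of u v] by (auto simp: \<rho>_def)
      then show "g (\<rho> u) \<noteq> g (\<rho> v)" using g \<rho>[OF uv(1)] \<rho>[OF uv(2)] by (auto simp: inj_on_def)
    qed
    show "card ((\<lambda>v. g (\<rho> v)) ` (K \<union> I)) \<le> card (q ` (K \<union> I))" if q: "proper_on (K \<union> I) q" for q
    proof -
      have "inj_on q K" using proper_on_inj_clique[OF q _ clique] by blast
      then have "card (g ` K) = card (q ` K)" using g by (simp add: card_image)
      also have "\<dots> \<le> card (q ` (K \<union> I))" using assms(1,2) by (intro card_mono) auto
      finally show ?thesis by (simp only: img)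
    qed
    fix L c
    assume c: "proper_on (K \<union> I) c" "c ` (K \<union> I) \<subseteq> L"
    have inj: "inj_on c K" using proper_on_inj_clique[OF c(1) _ clique] by blast
    have "recolours (K \<union> I) L (card I) c (\<lambda>v. if v \<in> I then c (r v) else c v)"
    proof (rule recolours_independent)
      show "(\<lambda>v. c (r v)) ` I \<subseteq> L" using c(2) r by blast
      show "c w \<noteq> c (r s)" if "s \<in> I" "w \<in> K \<union> I - I" "E s w" for s w
        using that r[of s] inj by (auto simp: inj_on_def)
    qed (use assms ind in auto)
    moreover have "same_kernel (K \<union> I) (\<lambda>v. c (\<rho> v)) (\<lambda>v. g (\<rho> v))"
      using same_kernel_inj[OF inj g] \<rho> by (simp add: same_kernel_def)
    moreover have "(\<lambda>v. if v \<in> I then c (r v) else c v) = (\<lambda>v. c (\<rho> v))"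
      by (auto simp: \<rho>_def)
    ultimately show "\<exists>d. recolours (K \<union> I) L (card I) c d \<and> same_kernel (K \<union> I) d (\<lambda>v. g (\<rho> v))"
      by auto
  qed
  then show thesis by (rule that)
qed

text \<open>One vertex \<open>b0\<close> of \<open>B\<close> serves all of \<open>I\<close>: the
  neighbours of \<open>I\<close> lie in \<open>K\<close>, which is complete to \<open>B\<close> and
  therefore avoids the colour of \<open>b0\<close>. The join of \<open>B\<close> and
  \<open>K\<close> supplies optimality. The recolouring itself acts on \<open>B\<close> alone, with
  the colours of \<open>K\<close> withheld, since moving vertices of \<open>K\<close> could clash
  with \<open>I\<close>.\<close>

lemma canonical_pseudo_split:
  assumes fin: "finite B" "finite K" "finite I"
    and disj: "B \<inter> K = {}" "B \<inter> I = {}" "K \<inter> I = {}" and b0: "b0 \<in> B"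
    and BK: "\<And>u v. u \<in> B \<Longrightarrow> v \<in> K \<Longrightarrow> E u v"
    and BI: "\<And>u v. u \<in> B \<Longrightarrow> v \<in> I \<Longrightarrow> \<not> E u v"
    and clique: "\<And>u v. u \<in> K \<Longrightarrow> v \<in> K \<Longrightarrow> u \<noteq> v \<Longrightarrow> E u v"
    and ind: "\<And>u v. u \<in> I \<Longrightarrow> v \<in> I \<Longrightarrow> \<not> E u v"
    and B: "canonical B m p"
  obtains q where "canonical (B \<union> K \<union> I) (m + card I) q"
proof -
  obtain p' where K: "canonical K 0 p'" using canonical_clique[OF fin(2) clique] by blast
  obtain s where s: "canonical (B \<union> K) (m + 0) s" and sp: "same_kernel B s p"
    using canonical_join[OF fin(1,2) disj(1) BK B K] by blast
  define \<rho> where "\<rho> v = (if v \<in> I then b0 else v)" for v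
  have \<rho>: "\<rho> v \<in> B \<union> K" if "v \<in> B \<union> K \<union> I" for v using that b0 by (auto simp: \<rho>_def)
  have \<rho>BK: "\<rho> v = v" if "v \<in> B \<union> K" for v using that disj by (auto simp: \<rho>_def)
  have adj: "E (\<rho> u) (\<rho> v)" if "u \<in> B \<union> K \<union> I" "v \<in> B \<union> K \<union> I" "E u v" for u v
    using that ind[of u v] BI[of u v] BI[of v u] sym[of u v] BK[OF b0, of u] BK[OF b0, of v]
      sym[of b0 u] by (auto simp: \<rho>_def)
  have img: "(\<lambda>v. s (\<rho> v)) ` (B \<union> K \<union> I) = s ` (B \<union> K)"
  proof
    show "(\<lambda>v. s (\<rho> v)) ` (B \<union> K \<union> I) \<subseteq> s ` (B \<union> K)" using \<rho> by blast
    show "s ` (B \<union> K) \<subseteq> (\<lambda>v. s (\<rho> v)) ` (B \<union> K \<union> I)"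
    proof
      fix x assume "x \<in> s ` (B \<union> K)"
      then obtain v where "v \<in> B \<union> K" "x = s v" by blast
      then show "x \<in> (\<lambda>v. s (\<rho> v)) ` (B \<union> K \<union> I)" using \<rho>BK[of v] by (intro image_eqI[of _ _ v]) auto
    qed
  qed
  have cross: "f u \<noteq> f v" if "proper_on (B \<union> K) f" "u \<in> B" "v \<in> K" for f u v
    using that BK by (auto simp: proper_on_def)
  have injK: "inj_on f K" if "proper_on (B \<union> K) f" for f
    using proper_on_inj_clique[OF that _ clique] by blast
  have ps: "proper_on (B \<union> K) s" using canonical_proper[OF s] .
  have "canonical (B \<union> K \<union> I) (m + card I) (\<lambda>v. s (\<rho> v))"
  proof (rule canonicalI)
    show "proper_on (B \<union> K \<union> I) (\<lambda>v. s (\<rho> v))"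
      unfolding proper_on_def using proper_onD[OF ps] adj \<rho> by blast
    show "card ((\<lambda>v. s (\<rho> v)) ` (B \<union> K \<union> I)) \<le> card (q ` (B \<union> K \<union> I))"
      if q: "proper_on (B \<union> K \<union> I) q" for q
    proof -
      have "card (s ` (B \<union> K)) \<le> card (q ` (B \<union> K))"
        using canonical_le[OF s] proper_on_subset[OF q] by blast
      also have "\<dots> \<le> card (q ` (B \<union> K \<union> I))" using fin by (intro card_mono) auto
      finally show ?thesis by (simp only: img)
    qed
    fix L c
    assume c: "finite L" "proper_on (B \<union> K \<union> I) c" "c ` (B \<union> K \<union> I) \<subseteq> L"
      "card ((\<lambda>v. s (\<rho> v)) ` (B \<union> K \<union> I)) < card L"
    have pc: "proper_on (B \<union> K) c" using proper_on_subset[OF c(2)] by blast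
    have "card (s ` (B \<union> K)) = card (s ` B) + card (s ` K)"
      using cross[OF ps] by (intro card_image_join fin) auto
    moreover have "card (s ` K) = card (c ` K)" using injK[OF ps] injK[OF pc] by (simp add: card_image)
    moreover have "card (p ` B) \<le> card (s ` B)"
      using canonical_le[OF B] proper_on_subset[OF ps] by blast
    moreover have "card (L - c ` K) = card L - card (c ` K)"
      using c(3) fin by (intro card_Diff_subset) auto
    moreover have "card (s ` (B \<union> K)) < card L" using c(4) by (simp only: img)
    \<comment> \<open>\<open>K\<close> occupies as many colours under \<open>c\<close> as under
      \<open>s\<close>, so the colour to spare for \<open>B \<union> K\<close> is one to spare for
      \<open>B\<close> alone.\<close>
    ultimately have "card (p ` B) < card (L - c ` K)" by linarith
    moreover have "c ` B \<subseteq> L - c ` K" using cross[OF pc] c(3) by auto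
    ultimately obtain d where d: "recolours B (L - c ` K) m c d" "same_kernel B d p"
      using canonical_recolours[OF B, of "L - c ` K" c] c(1) proper_on_subset[OF pc] by auto
    have d': "recolours (B \<union> K \<union> I) L m c d"
      using BI by (intro recolours_lift[OF d(1)]) auto
    have pd: "proper_on (B \<union> K \<union> I) d" "d ` (B \<union> K \<union> I) \<subseteq> L"
      using recolours_proper[OF d' c(2)] recolours_image[OF d' c(3)] by auto
    have pdBK: "proper_on (B \<union> K) d" using proper_on_subset[OF pd(1)] by blast
    have "recolours (B \<union> K \<union> I) L (card I) d (\<lambda>v. if v \<in> I then d b0 else d v)"
    proof (rule recolours_independent)
      show "(\<lambda>_. d b0) ` I \<subseteq> L" using pd(2) b0 by auto
      show "d w \<noteq> d b0" if "s \<in> I" "w \<in> B \<union> K \<union> I - I" "E s w" for s w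
        using that BI[of w s] sym[of s w] cross[OF pdBK b0, of w] by auto
    qed (use fin ind in auto)
    then have "recolours (B \<union> K \<union> I) L (card I) d (\<lambda>v. d (\<rho> v))"
      by (simp add: \<rho>_def if_distrib)
    from recolours_trans[OF this d'] have "recolours (B \<union> K \<union> I) L (m + card I) c (\<lambda>v. d (\<rho> v))" .
    moreover have "same_kernel (B \<union> K) d s"
    proof (rule same_kernel_Un)
      show "same_kernel B d s" using d(2) sp by (simp add: same_kernel_def)
      show "same_kernel K d s" using same_kernel_inj[OF injK[OF pdBK] injK[OF ps]] .
      show "d u = d v \<longleftrightarrow> s u = s v" if "u \<in> B" "v \<in> K" for u v
        using cross[OF pdBK that] cross[OF ps that] by simp
    qed
    then have "same_kernel (B \<union> K \<union> I) (\<lambda>v. d (\<rho> v)) (\<lambda>v. s (\<rho> v))"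
      using \<rho> by (simp add: same_kernel_def)
    ultimately show "\<exists>d. recolours (B \<union> K \<union> I) L (m + card I) c d \<and>
        same_kernel (B \<union> K \<union> I) d (\<lambda>v. s (\<rho> v))" by blast
  qed
  then show thesis by (rule that)
qed

text \<open>
  The clique is a maximum clique that leaves as few edges as possible outside.
\<close>

lemma split_if_2K2_C4_C5_free:
  assumes "finite V"
    and no2K2: "\<And>a b c d. a \<in> V \<Longrightarrow> b \<in> V \<Longrightarrow> c \<in> V \<Longrightarrow> d \<in> V \<Longrightarrow> E a b \<Longrightarrow> E c d \<Longrightarrow>
      E a c \<or> E a d \<or> E b c \<or> E b d"
    and noC4: "\<And>a b c d. a \<in> V \<Longrightarrow> b \<in> V \<Longrightarrow> c \<in> V \<Longrightarrow> d \<in> V \<Longrightarrow> E a b \<Longrightarrow> E b c \<Longrightarrow> E c d \<Longrightarrow> E d a \<Longrightarrow>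
      a \<noteq> c \<Longrightarrow> b \<noteq> d \<Longrightarrow> E a c \<or> E b d"
    and noC5: "\<And>a b c d e. a \<in> V \<Longrightarrow> b \<in> V \<Longrightarrow> c \<in> V \<Longrightarrow> d \<in> V \<Longrightarrow> e \<in> V \<Longrightarrow>
      E a b \<Longrightarrow> E b c \<Longrightarrow> E c d \<Longrightarrow> E d e \<Longrightarrow> E e a \<Longrightarrow> E a c \<or> E b d \<or> E c e \<or> E d a \<or> E e b"
  shows "\<exists>K \<subseteq> V. (\<forall>u \<in> K. \<forall>v \<in> K. u \<noteq> v \<longrightarrow> E u v) \<and>
    (\<forall>u \<in> V - K. \<forall>v \<in> V - K. \<not> E u v) \<and> (\<forall>v \<in> V - K. \<exists>k \<in> K. \<not> E v k)"
proof -
  define clique where "clique K \<longleftrightarrow> K \<subseteq> V \<and> (\<forall>u \<in> K. \<forall>v \<in> K. u \<noteq> v \<longrightarrow> E u v)" for K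
  \<comment> \<open>Each edge inside \<open>W\<close> is counted in both directions; only
    comparisons of these numbers matter.\<close>
  define arcs where "arcs W = {(u, v). u \<in> W \<and> v \<in> W \<and> E u v}" for W
  have finarcs: "finite (arcs W)" if "W \<subseteq> V" for W
    by (rule finite_subset[of _ "V \<times> V"]) (use that assms(1) in \<open>auto simp: arcs_def\<close>)
  obtain K0 where K0: "clique K0" "\<And>J. clique J \<Longrightarrow> card J \<le> card K0"
  proof -
    have "clique {}" by (simp add: clique_def)
    moreover have "card J < Suc (card V)" if "clique J" for J
      using that card_mono[OF assms(1)] by (simp add: clique_def less_Suc_eq_le)
    ultimately show thesis
      using that ex_has_greatest_nat[of clique "{}" card "Suc (card V)"] by blast
  qed
  obtain K where K: "clique K" "card K = card K0"
    and min: "\<And>J. clique J \<Longrightarrow> card J = card K0 \<Longrightarrow> card (arcs (V - K)) \<le> card (arcs (V - J))"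
    using ex_has_least_nat[of "\<lambda>J. clique J \<and> card J = card K0" K0 "\<lambda>J. card (arcs (V - J))"] K0(1)
    by auto
  have KE: "E u v" if "u \<in> K" "v \<in> K" "u \<noteq> v" for u v
    using K(1) that unfolding clique_def by blast
  have KV: "K \<subseteq> V" using K(1) by (simp add: clique_def)
  have finK: "finite K" using KV assms(1) finite_subset by blast
  have inV: "k \<in> V" if "k \<in> K" for k using that KV by blast
  have miss: "\<exists>k \<in> K. \<not> E v k" if v: "v \<in> V - K" for v
  proof (rule ccontr)
    assume "\<not> ?thesis"
    then have "clique (insert v K)"
      using K(1) v sym unfolding clique_def by (metis Diff_iff insertE insert_subset)
    from K0(2)[OF this] show False using v finK K(2) by simp
  qed
  \<comment> \<open>Two adjacent vertices outside \<open>K\<close> cannot have nested neighbourhoods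
    in \<open>K\<close>. If they had, the edge \<open>x y\<close> against the edges of
    \<open>K\<close> at \<open>z\<close> would force \<open>y\<close> to see all of \<open>K\<close>
    except \<open>z\<close>, so \<open>y\<close> could replace \<open>z\<close> in a maximum
    clique.\<close>
  have key: False if x: "x \<in> V - K" and y: "y \<in> V - K" and xy: "E x y"
    and nb: "\<And>k. k \<in> K \<Longrightarrow> E x k \<Longrightarrow> E y k" for x y
  proof -
    have xV: "x \<in> V" and yV: "y \<in> V" using x y by auto
    obtain z where z: "z \<in> K" "\<not> E y z" using miss[OF y] by blast
    have xz: "\<not> E x z" using nb z by blast
    have yk: "E y k" if k: "k \<in> K" "k \<noteq> z" for k
      using no2K2[of x y z k] xV yV inV[OF z(1)] inV[OF k(1)] xy KE[OF z(1) k(1)] k(2) z(2) xz nb[OF k(1)]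
      by blast
    define K' where "K' = insert y (K - {z})"
    have "clique K'"
      unfolding clique_def
    proof (intro conjI ballI impI)
      show "K' \<subseteq> V" using KV yV by (auto simp: K'_def)
      show "E u v" if "u \<in> K'" "v \<in> K'" "u \<noteq> v" for u v
        using that KE[of u v] yk[of u] yk[of v] sym[of y u] by (auto simp: K'_def)
    qed
    moreover have "card K' = card K0"
    proof -
      have "card K' = Suc (card (K - {z}))" using y finK by (simp add: K'_def)
      then show ?thesis using card_Suc_Diff1[OF finK z(1)] K(2) by simp
    qed
    ultimately have le: "card (arcs (V - K)) \<le> card (arcs (V - K'))" by (rule min)
    \<comment> \<open>Otherwise replacing \<open>z\<close> by \<open>y\<close> maps the arcs outside
      \<open>K'\<close> injectively to arcs outside \<open>K\<close>. The arc from \<open>y\<close>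
      to \<open>x\<close> is missed because \<open>z\<close> does not see \<open>x\<close>, so the
      exchange would contradict the choice of \<open>K\<close>.\<close>
    have "\<exists>w \<in> V - K. E z w \<and> \<not> E y w"
    proof (rule ccontr)
      assume "\<not> ?thesis"
      then have nw: "E y w" if "w \<in> V - K" "E z w" for w using that by blast
      define \<phi> where "\<phi> u = (if u = z then y else u)" for u
      have "inj_on (map_prod \<phi> \<phi>) (arcs (V - K'))"
        using z y by (auto simp: inj_on_def arcs_def \<phi>_def K'_def)
      then have "card (arcs (V - K')) = card (map_prod \<phi> \<phi> ` arcs (V - K'))"
        by (simp add: card_image)
      also have "\<dots> < card (arcs (V - K))"
      proof (rule psubset_card_mono)
        have "map_prod \<phi> \<phi> ` arcs (V - K') \<subseteq> arcs (V - K)"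
        proof
          fix e assume "e \<in> map_prod \<phi> \<phi> ` arcs (V - K')"
          then obtain u v where uv: "u \<in> V - K'" "v \<in> V - K'" "E u v" "e = (\<phi> u, \<phi> v)"
            by (auto simp: arcs_def)
          have "u = z \<or> u \<in> V - K" "v = z \<or> v \<in> V - K" using uv(1,2) by (auto simp: K'_def)
          then show "e \<in> arcs (V - K)"
            using uv(3,4) y nw[of v] nw[of u] sym[of u v] sym[of y u] irrefl[of z]
            by (auto simp: arcs_def \<phi>_def)
        qed
        moreover have "(y, x) \<in> arcs (V - K)" using x y sym[OF xy] by (simp add: arcs_def)
        moreover have "(y, x) \<notin> map_prod \<phi> \<phi> ` arcs (V - K')"
        proof
          assume "(y, x) \<in> map_prod \<phi> \<phi> ` arcs (V - K')"
          then obtain u v where uv: "u \<in> V - K'" "E u v" "\<phi> u = y" "\<phi> v = x"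
            unfolding arcs_def by auto
          have "u = z" using uv(1,3) unfolding \<phi>_def K'_def by (metis DiffD2 insertI1)
          moreover have "v = x" using uv(4) xy irrefl[of x] unfolding \<phi>_def by metis
          ultimately show False using uv(2) xz sym[of z x] by blast
        qed
        ultimately show "map_prod \<phi> \<phi> ` arcs (V - K') \<subset> arcs (V - K)" by blast
      qed (rule finarcs, blast)
      finally show False using le by simp
    qed
    then obtain w where w: "w \<in> V - K" "E z w" "\<not> E y w" by blast
    have wV: "w \<in> V" using w by blast
    have xw: "E x w"
      using no2K2[of x y z w] xV yV inV[OF z(1)] wV xy w z(2) xz by blast
    obtain a where a: "a \<in> K" "\<not> E w a" using miss[OF w(1)] by blast
    have az: "a \<noteq> z" using a w(2) sym by blast
    have ya: "E y a" using yk[OF a(1) az] .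
    have "E a z" using KE[OF a(1) z(1) az] .
    \<comment> \<open>According to whether \<open>x\<close> sees \<open>a\<close>, the vertices
      \<open>a\<close>, \<open>z\<close>, \<open>w\<close>, \<open>x\<close> form an induced 4-cycle
      or \<open>a\<close>, \<open>z\<close>, \<open>w\<close>, \<open>x\<close>, \<open>y\<close> an
      induced 5-cycle.\<close>
    show False
    proof (cases "E x a")
      case True
      then show False
        using noC4[of a z w x] inV[OF a(1)] inV[OF z(1)] wV xV \<open>E a z\<close> w(1,2) sym[OF xw] a
          x z(1) xz sym[of z x] sym[of a w] by blast
    next
      case False
      then show False
        using noC5[of a z w x y] inV[OF a(1)] inV[OF z(1)] wV xV yV \<open>E a z\<close> w(2,3) sym[OF xw] xy ya
          a(2) xz z(2) sym[of a w] sym[of z x] sym[of w y] by blast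
    qed
  qed
  \<comment> \<open>The neighbourhoods in \<open>K\<close> of two adjacent outside vertices are
    incomparable, and one private neighbour of each closes an induced 4-cycle.\<close>
  have ind: "\<not> E x y" if x: "x \<in> V - K" and y: "y \<in> V - K" for x y
  proof
    assume xy: "E x y"
    obtain a where a: "a \<in> K" "E x a" "\<not> E y a" using key[OF x y xy] by blast
    obtain b where b: "b \<in> K" "E y b" "\<not> E x b" using key[OF y x sym[OF xy]] by blast
    have "a \<noteq> b" using a b by blast
    then show False
      using noC4[of x a b y] KE[OF a(1) b(1)] inV[OF a(1)] inV[OF b(1)] x y a b sym[OF xy]
        sym[of y b] sym[of a y] by blast
  qed
  show ?thesis using KV KE ind miss by (intro exI[of _ K]) blast
qed

lemma canonical_2K2_C4_free:
  assumes "finite V"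
    and no2K2: "\<And>a b c d. a \<in> V \<Longrightarrow> b \<in> V \<Longrightarrow> c \<in> V \<Longrightarrow> d \<in> V \<Longrightarrow> E a b \<Longrightarrow> E c d \<Longrightarrow>
      E a c \<or> E a d \<or> E b c \<or> E b d"
    and noC4: "\<And>a b c d. a \<in> V \<Longrightarrow> b \<in> V \<Longrightarrow> c \<in> V \<Longrightarrow> d \<in> V \<Longrightarrow> E a b \<Longrightarrow> E b c \<Longrightarrow> E c d \<Longrightarrow> E d a \<Longrightarrow>
      a \<noteq> c \<Longrightarrow> b \<noteq> d \<Longrightarrow> E a c \<or> E b d"
  obtains p where "canonical V (card V) p"
proof -
  define C5 where "C5 a b c d e \<longleftrightarrow> {a, b, c, d, e} \<subseteq> V \<and> E a b \<and> E b c \<and> E c d \<and> E d e \<and> E e a \<and>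
      \<not> E a c \<and> \<not> E b d \<and> \<not> E c e \<and> \<not> E d a \<and> \<not> E e b" for a b c d e
  show thesis
  proof (cases "\<exists>a b c d e. C5 a b c d e")
    case False
    then have noC5: "E a c \<or> E b d \<or> E c e \<or> E d a \<or> E e b"
      if "a \<in> V" "b \<in> V" "c \<in> V" "d \<in> V" "e \<in> V" "E a b" "E b c" "E c d" "E d e" "E e a" for a b c d e
      using that unfolding C5_def by blast
    have "\<exists>K \<subseteq> V. (\<forall>u \<in> K. \<forall>v \<in> K. u \<noteq> v \<longrightarrow> E u v) \<and>
        (\<forall>u \<in> V - K. \<forall>v \<in> V - K. \<not> E u v) \<and> (\<forall>v \<in> V - K. \<exists>k \<in> K. \<not> E v k)"
      by (rule split_if_2K2_C4_C5_free[OF assms(1) no2K2 noC4 noC5])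
    then obtain K where K: "K \<subseteq> V" "\<forall>u \<in> K. \<forall>v \<in> K. u \<noteq> v \<longrightarrow> E u v"
      "\<forall>u \<in> V - K. \<forall>v \<in> V - K. \<not> E u v" "\<forall>v \<in> V - K. \<exists>k \<in> K. \<not> E v k"
      by auto
    have fin: "finite K" "finite (V - K)" using K(1) assms(1) finite_subset by auto
    obtain p where p: "canonical (K \<union> (V - K)) (card (V - K)) p"
      by (rule canonical_split[OF fin]) (use K(2-4) in auto)
    have "K \<union> (V - K) = V" using K(1) by blast
    with p have "canonical V (card (V - K)) p" by simp
    moreover have "card (V - K) \<le> card V" using assms(1) by (intro card_mono) auto
    ultimately show thesis using canonical_mono that by blast
  next
    case True
    then obtain a b c d e where abcde: "C5 a b c d e" by blast
    define B where "B = {a, b, c, d, e}"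
    have rot: "C5 q r s t p" if "C5 p q r s t" for p q r s t
      using that unfolding C5_def by auto
    \<comment> \<open>Adjacency to one vertex of the 5-cycle spreads to the next one. If
      \<open>v\<close> saw \<open>p\<close> but not \<open>q\<close>, then in turn it would miss
      \<open>r\<close> (4-cycle), see \<open>s\<close> (two disjoint edges) and see \<open>t\<close>
      (4-cycle), and the edges \<open>v t\<close> and \<open>q r\<close> would be independent.
      Rotating the cycle, an outside vertex sees all of it or nothing.\<close>
    have next_nb: "E v q" if C: "C5 p q r s t" and v: "v \<in> V" "v \<notin> {p, q, r, s, t}" "E v p" for v p q r s t
    proof (rule ccontr)
      assume vq: "\<not> E v q"
      have inV: "p \<in> V" "q \<in> V" "r \<in> V" "s \<in> V" "t \<in> V"
        and ed: "E p q" "E q r" "E r s" "E s t" "E t p"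
        and ned: "\<not> E p r" "\<not> E q s" "\<not> E r t" "\<not> E s p" "\<not> E t q"
        using C by (auto simp: C5_def)
      have "p \<noteq> r" "p \<noteq> s" using ed ned sym[of p q] sym[of r s] by auto
      have vr: "\<not> E v r"
        using noC4[of v p q r] v(1,3) inV ed sym[of v r] vq ned \<open>p \<noteq> r\<close> v(2) by auto
      have vs: "E v s"
        using no2K2[of v p r s] v(1,3) inV ed(3) vr ned(1,4) sym[of p s] by blast
      have vt: "E v t"
        using noC4[of v p t s] v(1,3) inV sym[OF ed(5)] sym[OF ed(4)] sym[OF vs] v(2) \<open>p \<noteq> s\<close> ned(4)
          sym[of p s] by auto
      show False
        using no2K2[of v t q r] v(1) inV vt ed(2) vq vr ned(3,5) sym[of t r] by blast
    qed
    have all_nb: "E v a \<Longrightarrow> E v b \<and> E v c \<and> E v d \<and> E v e"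
      and no_nb: "E v b \<or> E v c \<or> E v d \<or> E v e \<Longrightarrow> E v a" if "v \<in> V - B" for v
    proof -
      have r: "C5 b c d e a" "C5 c d e a b" "C5 d e a b c" "C5 e a b c d"
        using rot abcde by blast+
      have "E v a \<Longrightarrow> E v b" "E v b \<Longrightarrow> E v c" "E v c \<Longrightarrow> E v d" "E v d \<Longrightarrow> E v e" "E v e \<Longrightarrow> E v a"
        using next_nb[OF abcde, of v] next_nb[OF r(1), of v] next_nb[OF r(2), of v]
          next_nb[OF r(3), of v] next_nb[OF r(4), of v] that by (auto simp: B_def)
      then show "E v a \<Longrightarrow> E v b \<and> E v c \<and> E v d \<and> E v e"
        "E v b \<or> E v c \<or> E v d \<or> E v e \<Longrightarrow> E v a" by blast+
    qed
    have BV: "B \<subseteq> V" and ed: "E a b" "E b c" "E c d" "E d e" "E e a"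
      and ned: "\<not> E a c" "\<not> E b d" "\<not> E c e" "\<not> E d a" "\<not> E e b"
      using abcde by (auto simp: C5_def B_def)
    define K where "K = {v \<in> V - B. E v a}"
    define I where "I = {v \<in> V - B. \<not> E v a}"
    have fin: "finite B" "finite K" "finite I" using assms(1) by (auto simp: B_def K_def I_def)
    have BK: "E u v" if "u \<in> B" "v \<in> K" for u v
      using all_nb[of v] that sym[of v u] by (auto simp: B_def K_def)
    have BI: "\<not> E u v" if "u \<in> B" "v \<in> I" for u v
      using no_nb[of v] that sym[of u v] by (auto simp: B_def I_def)
    have "a \<noteq> c" using ed ned sym[of c d] by auto
    \<comment> \<open>Two non-adjacent vertices of \<open>K\<close> would form an induced 4-cycle
      with the non-adjacent cycle vertices \<open>a\<close> and \<open>c\<close>.\<close>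
    have clique: "E u v" if "u \<in> K" "v \<in> K" "u \<noteq> v" for u v
    proof -
      have "a \<in> B" "c \<in> B" by (simp_all add: B_def)
      then have "E u a" "E a v" "E v c" "E c u" using BK that sym by blast+
      moreover have "u \<in> V" "v \<in> V" "a \<in> V" "c \<in> V"
        using that BV \<open>a \<in> B\<close> \<open>c \<in> B\<close> by (auto simp: K_def)
      ultimately show ?thesis using noC4[of u a v c] that(3) ned(1) \<open>a \<noteq> c\<close> by blast
    qed
    have ind: "\<not> E u v" if "u \<in> I" "v \<in> I" for u v
    proof -
      have "a \<in> B" "b \<in> B" by (simp_all add: B_def)
      moreover have "u \<in> V" "v \<in> V" "a \<in> V" "b \<in> V"
        using that BV \<open>a \<in> B\<close> \<open>b \<in> B\<close> by (auto simp: I_def)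
      ultimately show ?thesis using no2K2[of a b u v] BI that ed(1) by blast
    qed
    \<comment> \<open>A 5-cycle has no three independent vertices, so its partition is reached in
      \<open>card B\<close> steps.\<close>
    obtain p where p: "canonical B (card B) p"
    proof (rule canonical_3K1_free[OF fin(1)])
      fix x y z assume "x \<in> B" "y \<in> B" "z \<in> B" "x \<noteq> y" "y \<noteq> z" "x \<noteq> z"
      then show "E x y \<or> E y z \<or> E x z"
        using ed sym[OF ed(1)] sym[OF ed(2)] sym[OF ed(3)] sym[OF ed(4)] sym[OF ed(5)]
        unfolding B_def by fast
    qed
    have disj: "B \<inter> K = {}" "B \<inter> I = {}" "K \<inter> I = {}" by (auto simp: K_def I_def)
    have "a \<in> B" by (simp add: B_def)
    obtain q where q: "canonical (B \<union> K \<union> I) (card B + card I) q"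
      by (rule canonical_pseudo_split[OF fin disj \<open>a \<in> B\<close> BK BI clique ind p])
    have "B \<union> K \<union> I = V" using BV by (auto simp: K_def I_def)
    with q have "canonical V (card B + card I) q" by simp
    moreover have "card B + card I \<le> card V"
      using card_mono[OF assms(1), of "B \<union> I"] card_Un_disjoint[OF fin(1,3) disj(2)] BV
      by (auto simp: I_def)
    ultimately show thesis using canonical_mono that by blast
  qed
qed

end

section \<open>The diameter of the colouring graph\<close>

lemma edge_in_verts:
  assumes "simple_graph G" "{u, v} \<in> edges G"
  shows "u \<in> verts G" "v \<in> verts G" "u \<noteq> v"
  using assms by (force simp: simple_graph_def)+

lemma adjacency_relation_edges:
  assumes "simple_graph G"
  shows "adjacency_relation (\<lambda>u v. {u, v} \<in> edges G)"
  using edge_in_verts(3)[OF assms] by unfold_locales (auto simp: insert_commute simp del: insert_absorb2)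

lemma proper_colourings_iff:
  assumes "simple_graph G"
  shows "c \<in> proper_colourings G l \<longleftrightarrow>
    c \<in> verts G \<rightarrow>\<^sub>E {1..l} \<and> adjacency_relation.proper_on (\<lambda>u v. {u, v} \<in> edges G) (verts G) c"
  using edge_in_verts[OF assms]
  unfolding proper_colourings_def adjacency_relation.proper_on_def[OF adjacency_relation_edges[OF assms]]
  by blast

text \<open>A step that keeps the colour is no edge of the colouring graph and is dropped, so the
  walk may be shorter than the index.\<close>

lemma recolours_adjacency:
  assumes G: "simple_graph G"
    and "adjacency_relation.recolours (\<lambda>u v. {u, v} \<in> edges G) (verts G) {1..l} k c d"
    and "c \<in> proper_colourings G l"
  shows "d \<in> proper_colourings G l \<and> (\<exists>j\<le>k. (c, d) \<in> adjacency (colouring_graph l G) ^^ j)"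
proof -
  interpret adjacency_relation "\<lambda>u v. {u, v} \<in> edges G" by (rule adjacency_relation_edges[OF G])
  show ?thesis
    using assms(2,3)
  proof (induction rule: recolours.induct)
    case (refl k c)
    then show ?case by (intro conjI exI[of _ 0]) auto
  next
    case (step k c d v x)
    then obtain j where d: "d \<in> proper_colourings G l" and j: "j \<le> k"
      "(c, d) \<in> adjacency (colouring_graph l G) ^^ j" by blast
    have "recolours (verts G) {1..l} (Suc 0) d (d(v := x))"
      by (rule recolours.step[OF recolours.refl step(2-4)])
    then have "proper_on (verts G) (d(v := x))"
      using recolours_proper d proper_colourings_iff[OF G] by blast
    moreover have "d(v := x) \<in> verts G \<rightarrow>\<^sub>E {1..l}"
      using d step(2,3) unfolding proper_colourings_def by (auto simp: PiE_iff extensional_def)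
    ultimately have e: "d(v := x) \<in> proper_colourings G l"
      using proper_colourings_iff[OF G] by blast
    show ?case
    proof (cases "d v = x")
      case True
      then have "d(v := x) = d" by auto
      then show ?thesis using e j by (metis le_SucI)
    next
      case False
      then have "\<exists>!u. u \<in> verts G \<and> d u \<noteq> (d(v := x)) u" using step(2) by auto
      with d e have "{d, d(v := x)} \<in> edges (colouring_graph l G)"
        unfolding colouring_graph_def graph.simps by blast
      then have "(d, d(v := x)) \<in> adjacency (colouring_graph l G)" by (simp add: adjacency_def)
      with j(2) have "(c, d(v := x)) \<in> adjacency (colouring_graph l G) ^^ Suc j"
        by (rule relpow_Suc_I)
      with e j(1) show ?thesis by (metis Suc_le_mono)
    qed
  qed
qed

text \<open>Optimality of \<open>p\<close> bounds its number of colours by the chromatic number, so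
  \<open>l\<close> colours contain the spare one. The two colourings agree outside the vertex set
  because they are extensional.\<close>

lemma diameter_le:
  assumes G: "finite_simple_graph G" and l: "l \<ge> chromatic_number G + 1"
    and p: "adjacency_relation.canonical (\<lambda>u v. {u, v} \<in> edges G) (verts G) m p"
  shows "diameter (colouring_graph l G) \<le> enat (2 * m + 3 * card (verts G) div 2)"
proof -
  have sG: "simple_graph G" and fin: "finite (verts G)"
    using G by (auto simp: finite_simple_graph_def)
  interpret adjacency_relation "\<lambda>u v. {u, v} \<in> edges G" by (rule adjacency_relation_edges[OF sG])
  obtain q where q: "q \<in> proper_colourings G (chromatic_number G)"
    using proper_colourings_chromatic_number[OF G] by blast
  then have "card (p ` verts G) \<le> card (q ` verts G)"
    using canonical_le[OF p] proper_colourings_iff[OF sG] by blast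
  also have "\<dots> \<le> card {1..chromatic_number G}"
    using q by (intro card_mono) (auto simp: proper_colourings_def)
  finally have chi: "card (p ` verts G) < card {1..l}" using l by simp
  have "graph_distance (colouring_graph l G) c d \<le> enat (2 * m + 3 * card (verts G) div 2)"
    if c: "c \<in> proper_colourings G l" and d: "d \<in> proper_colourings G l" for c d
  proof -
    have "recolours (verts G) {1..l} (2 * m + 3 * card (verts G) div 2) c d"
    proof (rule canonical_connects[OF fin p _ chi])
      show "c ` verts G \<subseteq> {1..l}" "d ` verts G \<subseteq> {1..l}" "\<And>v. v \<notin> verts G \<Longrightarrow> c v = d v"
        using c d unfolding proper_colourings_def by (auto simp: PiE_iff extensional_def)
    qed (use c d proper_colourings_iff[OF sG] in auto)
    then obtain j where "j \<le> 2 * m + 3 * card (verts G) div 2"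
      "(c, d) \<in> adjacency (colouring_graph l G) ^^ j"
      using recolours_adjacency[OF sG _ c] by blast
    then have "graph_distance (colouring_graph l G) c d \<le> enat j"
      unfolding graph_distance_def by (intro Inf_lower) blast
    also have "\<dots> \<le> enat (2 * m + 3 * card (verts G) div 2)" using \<open>j \<le> _\<close> by simp
    finally show ?thesis .
  qed
  then show ?thesis
    unfolding diameter_def by (intro Sup_least) (auto simp: colouring_graph_def)
qed

section \<open>Forbidden induced subgraphs\<close>

text \<open>Isomorphisms run from the induced subgraph to \<open>H\<close>, so the inverse of the
  embedding \<open>g\<close> is the witness.\<close>

lemma not_induced_free:
  assumes G: "simple_graph G" and H: "simple_graph H"
    and g: "inj_on g (verts H)" "g ` verts H \<subseteq> verts G"
    and adj: "\<And>x y. x \<in> verts H \<Longrightarrow> y \<in> verts H \<Longrightarrow> {x, y} \<in> edges H \<longleftrightarrow> {g x, g y} \<in> edges G"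
  shows "\<not> induced_free H G"
proof -
  define f where "f = inv_into (verts H) g"
  have fg: "f (g x) = x" if "x \<in> verts H" for x using that g(1) by (simp add: f_def)
  have "bij_betw f (g ` verts H) (verts H)"
    unfolding f_def using g(1) by (intro bij_betw_inv_into) (simp add: bij_betw_def)
  moreover have "edges H = image f ` {e \<in> edges G. e \<subseteq> g ` verts H}"
  proof (intro equalityI subsetI)
    fix e assume e: "e \<in> edges H"
    then obtain x y where xy: "e = {x, y}" "x \<in> verts H" "y \<in> verts H"
      using H by (auto simp: simple_graph_def card_2_iff)
    then have "{g x, g y} \<in> edges G" "f ` {g x, g y} = e" using adj e fg by auto
    then show "e \<in> image f ` {e \<in> edges G. e \<subseteq> g ` verts H}" using xy by blast
  next
    fix e assume "e \<in> image f ` {e \<in> edges G. e \<subseteq> g ` verts H}"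
    then obtain e' where e': "e' \<in> edges G" "e' \<subseteq> g ` verts H" "e = f ` e'" by blast
    obtain u v where "e' = {u, v}" using e'(1) G by (auto simp: simple_graph_def card_2_iff)
    then obtain x y where "x \<in> verts H" "y \<in> verts H" "e' = {g x, g y}" using e'(2) by auto
    then show "e \<in> edges H" using e' adj fg by simp
  qed
  ultimately have "graph_isomorphic (induced_subgraph G (g ` verts H)) H"
    unfolding graph_isomorphic_def induced_subgraph_def by auto
  then show ?thesis using g(2) unfolding induced_free_def by blast
qed

lemma P3_plus_P1_simps:
  "verts P3_plus_P1 = {Inl 0, Inl 1, Inl 2, Inr 0}"
  "edges P3_plus_P1 = {{Inl 0, Inl 1}, {Inl 1, Inl 2}}"
proof -
  have "{..<3} = {0, 1, 2::nat}" "{..<1} = {0::nat}" by auto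
  then show "verts P3_plus_P1 = {Inl 0, Inl 1, Inl 2, Inr 0}"
    by (simp add: P3_plus_P1_def disjoint_union_graph_def path_graph_def Plus_def insert_commute)
  have "{{i, Suc i} |i. Suc i < 3} = {{0, 1}, {1, 2}}"
    by (auto simp: less_Suc_eq numeral_eq_Suc)
  then show "edges P3_plus_P1 = {{Inl 0, Inl 1}, {Inl 1, Inl 2}}"
    by (simp add: P3_plus_P1_def disjoint_union_graph_def path_graph_def)
qed

lemma two_K2_simps:
  "verts two_K2 = {Inl 0, Inl 1, Inr 0, Inr 1}"
  "edges two_K2 = {{Inl 0, Inl 1}, {Inr 0, Inr 1}}"
proof -
  have "{..<2} = {0, 1::nat}" by auto
  then show "verts two_K2 = {Inl 0, Inl 1, Inr 0, Inr 1}"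
    by (simp add: two_K2_def disjoint_union_graph_def complete_graph_def Plus_def insert_commute)
  have "{{i, j} |i j. i < 2 \<and> j < 2 \<and> i \<noteq> j} = {{0, 1::nat}}"
    by (auto simp: less_Suc_eq numeral_eq_Suc)
  then show "edges two_K2 = {{Inl 0, Inl 1}, {Inr 0, Inr 1}}"
    by (simp add: two_K2_def disjoint_union_graph_def complete_graph_def insert_commute)
qed

lemma P3_plus_P1_freeD:
  assumes G: "simple_graph G" "induced_free P3_plus_P1 G"
    and "a \<in> verts G" "b \<in> verts G" "c \<in> verts G" "d \<in> verts G" "a \<noteq> c"
    and E: "{a, b} \<in> edges G" "{b, c} \<in> edges G" "{a, c} \<notin> edges G"
  shows "{d, a} \<in> edges G \<or> {d, b} \<in> edges G \<or> {d, c} \<in> edges G"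
proof (rule ccontr)
  assume "\<not> ?thesis"
  then have nd: "{d, a} \<notin> edges G" "{d, b} \<notin> edges G" "{d, c} \<notin> edges G" by auto
  have E': "{b, a} \<in> edges G" "{c, b} \<in> edges G" "{c, a} \<notin> edges G"
    and nd': "{a, d} \<notin> edges G" "{b, d} \<notin> edges G" "{c, d} \<notin> edges G"
    using E nd by (simp_all add: insert_commute)
  define g where "g = case_sum (\<lambda>i::nat. if i = 0 then a else if i = 1 then b else c) (\<lambda>_::nat. d)"
  have loop: "{x} \<notin> edges G" for x using edge_in_verts(3)[OF G(1), of x x] by auto
  \<comment> \<open>Each coincidence would turn an edge into a loop or one of the non-edges at
    \<open>d\<close> into an edge.\<close>
  have ne: "a \<noteq> b" "b \<noteq> c" "d \<noteq> a" "d \<noteq> b" "d \<noteq> c"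
    using E nd loop by (auto simp: insert_commute)
  have "\<not> induced_free P3_plus_P1 G"
  proof (rule not_induced_free[OF G(1), where g = g])
    show "simple_graph P3_plus_P1" using simple_graph_P3_plus_P1 by (simp add: finite_simple_graph_def)
    show "inj_on g (verts P3_plus_P1)" "g ` verts P3_plus_P1 \<subseteq> verts G"
      using assms ne by (auto simp: P3_plus_P1_simps g_def)
    show "{x, y} \<in> edges P3_plus_P1 \<longleftrightarrow> {g x, g y} \<in> edges G"
      if "x \<in> verts P3_plus_P1" "y \<in> verts P3_plus_P1" for x y
      using that unfolding P3_plus_P1_simps
      by (elim insertE emptyE; simp add: g_def doubleton_eq_iff E nd loop E' nd')
  qed
  then show False using G(2) by blast
qed

lemma two_K2_freeD:
  assumes G: "simple_graph G" "induced_free two_K2 G"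
    and "a \<in> verts G" "b \<in> verts G" "c \<in> verts G" "d \<in> verts G"
    and E: "{a, b} \<in> edges G" "{c, d} \<in> edges G"
  shows "{a, c} \<in> edges G \<or> {a, d} \<in> edges G \<or> {b, c} \<in> edges G \<or> {b, d} \<in> edges G"
proof (rule ccontr)
  assume "\<not> ?thesis"
  then have nd: "{a, c} \<notin> edges G" "{a, d} \<notin> edges G" "{b, c} \<notin> edges G" "{b, d} \<notin> edges G" by auto
  have E': "{b, a} \<in> edges G" "{d, c} \<in> edges G"
    and nd': "{c, a} \<notin> edges G" "{d, a} \<notin> edges G" "{c, b} \<notin> edges G" "{d, b} \<notin> edges G"
    using E nd by (simp_all add: insert_commute)
  define g where "g = case_sum (\<lambda>i::nat. if i = 0 then a else b) (\<lambda>i::nat. if i = 0 then c else d)"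
  have loop: "{x} \<notin> edges G" for x using edge_in_verts(3)[OF G(1), of x x] by auto
  have ne: "a \<noteq> b" "c \<noteq> d" "a \<noteq> c" "a \<noteq> d" "b \<noteq> c" "b \<noteq> d"
    using E nd loop by (auto simp: insert_commute)
  have "\<not> induced_free two_K2 G"
  proof (rule not_induced_free[OF G(1), where g = g])
    show "simple_graph two_K2" using simple_graph_two_K2 by (simp add: finite_simple_graph_def)
    show "inj_on g (verts two_K2)" "g ` verts two_K2 \<subseteq> verts G"
      using assms ne by (auto simp: two_K2_simps g_def)
    show "{x, y} \<in> edges two_K2 \<longleftrightarrow> {g x, g y} \<in> edges G"
      if "x \<in> verts two_K2" "y \<in> verts two_K2" for x y
      using that unfolding two_K2_simps
      by (elim insertE emptyE; simp add: g_def doubleton_eq_iff E nd loop E' nd')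
  qed
  then show False using G(2) by blast
qed

lemma C4_freeD:
  assumes G: "simple_graph G" "induced_free C4 G"
    and "a \<in> verts G" "b \<in> verts G" "c \<in> verts G" "d \<in> verts G"
    and E: "{a, b} \<in> edges G" "{b, c} \<in> edges G" "{c, d} \<in> edges G" "{d, a} \<in> edges G"
    and "a \<noteq> c" "b \<noteq> d"
  shows "{a, c} \<in> edges G \<or> {b, d} \<in> edges G"
proof (rule ccontr)
  assume "\<not> ?thesis"
  then have nd: "{a, c} \<notin> edges G" "{b, d} \<notin> edges G" by auto
  have E': "{b, a} \<in> edges G" "{c, b} \<in> edges G" "{d, c} \<in> edges G" "{a, d} \<in> edges G"
    and nd': "{c, a} \<notin> edges G" "{d, b} \<notin> edges G"
    using E nd by (simp_all add: insert_commute)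
  define g where "g i = (if i = 0 then a else if i = 1 then b else if i = 2 then c else d)" for i :: nat
  have loop: "{x} \<notin> edges G" for x using edge_in_verts(3)[OF G(1), of x x] by auto
  have ne: "a \<noteq> b" "b \<noteq> c" "c \<noteq> d" "d \<noteq> a"
    using E loop by (auto simp: insert_commute)
  have verts: "verts C4 = {0, 1, 2, 3}" by (auto simp: C4_def cycle_graph_def)
  have "\<not> induced_free C4 G"
  proof (rule not_induced_free[OF G(1), where g = g])
    show "simple_graph C4" using simple_graph_C4 by (simp add: finite_simple_graph_def)
    show "inj_on g (verts C4)" "g ` verts C4 \<subseteq> verts G"
      using assms ne by (auto simp: verts g_def)
    show "{x, y} \<in> edges C4 \<longleftrightarrow> {g x, g y} \<in> edges G" if "x \<in> verts C4" "y \<in> verts C4" for x y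
      using that unfolding verts C4_edges
      by (elim insertE emptyE; simp add: g_def doubleton_eq_iff E nd loop E' nd')
  qed
  then show False using G(2) by blast
qed

lemma diameter_P3_plus_P1_free:
  assumes G: "finite_simple_graph G" "induced_free P3_plus_P1 G"
    and l: "l \<ge> chromatic_number G + 1"
  shows "diameter (colouring_graph l G) \<le> enat (nat \<lfloor>(4 + 1/2) * real (card (verts G))\<rfloor>)"
proof -
  let ?n = "card (verts G)"
  have sG: "simple_graph G" and fin: "finite (verts G)"
    using G(1) by (auto simp: finite_simple_graph_def)
  have "\<exists>m p. 2 * m \<le> 3 * ?n \<and>
      adjacency_relation.canonical (\<lambda>u v. {u, v} \<in> edges G) (verts G) m p"
    by (rule adjacency_relation.canonical_P3_P1_free[OF adjacency_relation_edges[OF sG] fin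
          P3_plus_P1_freeD[OF sG G(2)]])
  then obtain m p where m: "2 * m \<le> 3 * ?n"
    "adjacency_relation.canonical (\<lambda>u v. {u, v} \<in> edges G) (verts G) m p" by blast
  have "diameter (colouring_graph l G) \<le> enat (2 * m + 3 * ?n div 2)"
    using diameter_le[OF G(1) l m(2)] .
  \<comment> \<open>Both ways to the partition cost at most \<open>3 * ?n\<close> together, and the
    renaming adds half of that.\<close>
  also have "2 * m + 3 * ?n div 2 \<le> nat \<lfloor>(4 + 1/2) * real ?n\<rfloor>"
  proof (rule le_nat_floor)
    have "real (3 * ?n div 2) \<le> 3 * real ?n / 2" using of_nat_div_le_of_nat[of "3 * ?n" 2] by simp
    moreover have "2 * real m \<le> 3 * real ?n" using m(1) by linarith
    ultimately show "real (2 * m + 3 * ?n div 2) \<le> (4 + 1/2) * real ?n" by simp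
  qed
  finally show ?thesis by simp
qed

lemma diameter_2K2_C4_free:
  assumes G: "finite_simple_graph G" "induced_free two_K2 G" "induced_free C4 G"
    and l: "l \<ge> chromatic_number G + 1"
  shows "diameter (colouring_graph l G) \<le> enat (nat \<lfloor>7 * real (card (verts G)) / 2\<rfloor>)"
proof -
  let ?n = "card (verts G)"
  have sG: "simple_graph G" and fin: "finite (verts G)"
    using G(1) by (auto simp: finite_simple_graph_def)
  obtain p where "adjacency_relation.canonical (\<lambda>u v. {u, v} \<in> edges G) (verts G) ?n p"
    by (rule adjacency_relation.canonical_2K2_C4_free[OF adjacency_relation_edges[OF sG] fin
          two_K2_freeD[OF sG G(2)] C4_freeD[OF sG G(3)]])
  then have "diameter (colouring_graph l G) \<le> enat (2 * ?n + 3 * ?n div 2)"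
    by (rule diameter_le[OF G(1) l])
  also have "2 * ?n + 3 * ?n div 2 \<le> nat \<lfloor>7 * real ?n / 2\<rfloor>"
  proof (rule le_nat_floor)
    have "real (3 * ?n div 2) \<le> 3 * real ?n / 2" using of_nat_div_le_of_nat[of "3 * ?n" 2] by simp
    then show "real (2 * ?n + 3 * ?n div 2) \<le> 7 * real ?n / 2" by simp
  qed
  finally show ?thesis by simp
qed

theorem corollary3:
  fixes G :: "'a graph" and n l :: nat
  assumes "finite_simple_graph G"
    and "card (verts G) = n"
    and "l \<ge> chromatic_number G + 1"
  shows "(induced_free P3_plus_P1 G \<longrightarrow>
            diameter (colouring_graph l G) \<le> enat (nat \<lfloor>(4 + 1/2) * real n\<rfloor>)) \<and>
         (induced_free two_K2 G \<and> induced_free C4 G \<longrightarrow>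
            diameter (colouring_graph l G) \<le> enat (nat \<lfloor>7 * real n / 2\<rfloor>))"
  using diameter_P3_plus_P1_free[OF assms(1) _ assms(3)]
    diameter_2K2_C4_free[OF assms(1) _ _ assms(3)]
  unfolding assms(2) by blast

end
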